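(* Let $v\ge0$ be an integer and $n$ a positive integer with $v_2(n)\ge v$. Let $\lambda$ be an odd partition of $n$. Then the map $\mu\mapsto\mathrm{core}_{2^v}(\mu)$ is an isomorphism of trees $$\lambda^{+[0,2^v-1]}\to\emptyset^{+[0,2^v-1]}.$$
   Context: For a partition $\lambda$, $f_\lambda$ is the number of standard Young tableaux of shape $\lambda$; $\lambda$ is odd if $f_\lambda$ is odd, and $\Lambda^{\mathrm{odd}}$ is the set of odd partitions. The subgraph of Young's graph (Hasse diagram of partitions under containment) induced on $\Lambda^{\mathrm{odd}}$ is a rooted tree. For $\lambda\in\Lambda^{\mathrm{odd}}$ and $k\ge0$, $\lambda^{+[0,k]}$ denotes the induced subgraph (subtree) on the set of $\mu\in\Lambda^{\mathrm{odd}}$ with $\mu\supseteq\lambda$ and $|\lambda|\le|\mu|\le|\lambda|+k$. $v_2$ is the $2$-adic valuation. For $p>1$, $\mathrm{core}_p(\mu)$ is the $p$-core of $\mu$ (obtained by repeatedly removing rim hooks of length $p$ until none remain); $\mathrm{core}_1(\mu)=\emptyset$.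
   Formalization: In $\lambda^{+[0,k]}$ the condition $\mu\supseteq\lambda$ is read as: $\mu$ is a descendant of $\lambda$ in the tree of odd partitions; with plain containment the claim fails, e.g. $v=2$, $\lambda=(4)$, where $(4,2)$ is odd and contains $(4)$ but is not a descendant. *)

theory Defs
  imports "HOL-Library.FuncSet" "HOL-Computational_Algebra.Primes"
begin

definition is_partition :: "nat list \<Rightarrow> bool" where
  "is_partition \<mu> \<longleftrightarrow> sorted_wrt (\<ge>) \<mu> \<and> 0 \<notin> set \<mu>"

text \<open>The size of a partition \<open>\<mu>\<close> is \<^term>\<open>sum_list \<mu>\<close>. Rows and columns of cells
  are numbered from 0, in English convention.\<close>

definition diagram :: "nat list \<Rightarrow> (nat \<times> nat) set" where
  "diagram \<mu> = {(i, j). i < length \<mu> \<and> j < \<mu> ! i}"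

text \<open>Requiring \<open>extensional\<close> makes a tableau determined by its entries inside the shape, so
  that cardinality counts tableaux.\<close>

definition standard_tableaux :: "nat list \<Rightarrow> (nat \<times> nat \<Rightarrow> nat) set" where
  "standard_tableaux \<mu> =
     {T \<in> extensional (diagram \<mu>).
        bij_betw T (diagram \<mu>) {1..sum_list \<mu>} \<and>
        (\<forall>i j j'. (i, j) \<in> diagram \<mu> \<and> (i, j') \<in> diagram \<mu> \<and> j < j' \<longrightarrow> T (i, j) < T (i, j')) \<and>
        (\<forall>i i' j. (i, j) \<in> diagram \<mu> \<and> (i', j) \<in> diagram \<mu> \<and> i < i' \<longrightarrow> T (i, j) < T (i', j))}"

definition num_syt :: "nat list \<Rightarrow> nat" where
  "num_syt \<mu> = card (standard_tableaux \<mu>)"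

definition odd_partitions :: "nat list set" where
  "odd_partitions = {\<mu>. is_partition \<mu> \<and> odd (num_syt \<mu>)}"

definition contained_in :: "nat list \<Rightarrow> nat list \<Rightarrow> bool" where
  "contained_in \<mu> \<nu> \<longleftrightarrow> diagram \<mu> \<subseteq> diagram \<nu>"

definition young_covers :: "nat list \<Rightarrow> nat list \<Rightarrow> bool" where
  "young_covers \<mu> \<nu> \<longleftrightarrow>
     is_partition \<mu> \<and> is_partition \<nu> \<and> contained_in \<mu> \<nu> \<and> \<mu> \<noteq> \<nu> \<and>
     (\<forall>\<kappa>. is_partition \<kappa> \<and> contained_in \<mu> \<kappa> \<and> contained_in \<kappa> \<nu> \<longrightarrow> \<kappa> = \<mu> \<or> \<kappa> = \<nu>)"

definition young_edges :: "nat list set set" where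
  "young_edges = {{\<mu>, \<nu>} | \<mu> \<nu>. young_covers \<mu> \<nu>}"

text \<open>A rooted graph is a triple of vertices, edges (two-element sets of vertices) and root.\<close>

type_synonym 'a rooted_graph = "'a set \<times> 'a set set \<times> 'a"

definition young_induced :: "nat list set \<Rightarrow> nat list \<Rightarrow> nat list rooted_graph" where
  "young_induced V r = (V, {e \<in> young_edges. e \<subseteq> V}, r)"

text \<open>The order of the tree of odd partitions: \<open>\<mu>\<close> lies below \<open>\<nu>\<close> if \<open>\<nu>\<close> is reached from \<open>\<mu>\<close> by
  going up through odd partitions along edges of Young's graph. This implies containment but is
  strictly stronger: \<open>[4]\<close> and \<open>[4, 2]\<close> are odd, yet the only odd partition covered by
  \<open>[4, 2]\<close> is \<open>[3, 2]\<close>.\<close>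

definition odd_tree_le :: "nat list \<Rightarrow> nat list \<Rightarrow> bool" where
  "odd_tree_le =
     (\<lambda>\<mu> \<nu>. \<mu> \<in> odd_partitions \<and> \<nu> \<in> odd_partitions \<and> young_covers \<mu> \<nu>)\<^sup>*\<^sup>*"

text \<open>The tree \<open>\<rho>\<^sup>+\<^sup>[\<^sup>0\<^sup>,\<^sup>k\<^sup>]\<close>. The condition \<open>\<mu> \<supseteq> \<rho>\<close> is read in the order of the tree of odd
  partitions; with plain containment the induced subgraph on \<open>[4]\<^sup>+\<^sup>[\<^sup>0\<^sup>,\<^sup>3\<^sup>]\<close> would contain
  \<open>[4, 2]\<close> but not its parent, and so would not be a subtree.\<close>

definition odd_subtree :: "nat list \<Rightarrow> nat \<Rightarrow> nat list rooted_graph" where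
  "odd_subtree \<rho> k =
     young_induced
       {\<mu> \<in> odd_partitions. odd_tree_le \<rho> \<mu> \<and> sum_list \<rho> \<le> sum_list \<mu> \<and> sum_list \<mu> \<le> sum_list \<rho> + k}
       \<rho>"

fun rooted_graph_iso :: "('a \<Rightarrow> 'b) \<Rightarrow> 'a rooted_graph \<Rightarrow> 'b rooted_graph \<Rightarrow> bool" where
  "rooted_graph_iso f (V, E, r) (V', E', r') \<longleftrightarrow>
     bij_betw f V V' \<and>
     (\<forall>x\<in>V. \<forall>y\<in>V. {x, y} \<in> E \<longleftrightarrow> {f x, f y} \<in> E') \<and>
     f r = r'"

fun adjacent_cells :: "nat \<times> nat \<Rightarrow> nat \<times> nat \<Rightarrow> bool" where
  "adjacent_cells (i, j) (k, l) \<longleftrightarrow>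
     (i = k \<and> (l = Suc j \<or> j = Suc l)) \<or> (j = l \<and> (k = Suc i \<or> i = Suc k))"

definition connected_cells :: "(nat \<times> nat) set \<Rightarrow> bool" where
  "connected_cells S \<longleftrightarrow>
     (\<forall>a\<in>S. \<forall>b\<in>S. (a, b) \<in> {(x, y). x \<in> S \<and> y \<in> S \<and> adjacent_cells x y}\<^sup>*)"

definition rim :: "nat list \<Rightarrow> (nat \<times> nat) set" where
  "rim \<mu> = {(i, j) \<in> diagram \<mu>. (Suc i, Suc j) \<notin> diagram \<mu>}"

text \<open>\<open>\<nu>\<close> arises from \<open>\<mu>\<close> by removing a rim hook of length \<open>p\<close>: a connected set of \<open>p\<close> cells
  of the rim whose removal leaves the diagram of a partition.\<close>

definition removes_rim_hook :: "nat \<Rightarrow> nat list \<Rightarrow> nat list \<Rightarrow> bool" where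
  "removes_rim_hook p \<mu> \<nu> \<longleftrightarrow>
     is_partition \<mu> \<and> is_partition \<nu> \<and> contained_in \<nu> \<mu> \<and>
     diagram \<mu> - diagram \<nu> \<subseteq> rim \<mu> \<and>
     connected_cells (diagram \<mu> - diagram \<nu>) \<and>
     card (diagram \<mu> - diagram \<nu>) = p"

definition core :: "nat \<Rightarrow> nat list \<Rightarrow> nat list" where
  "core p \<mu> =
     (if p = 1 then []
      else THE \<nu>. (removes_rim_hook p)\<^sup>*\<^sup>* \<mu> \<nu> \<and> \<not> (\<exists>\<kappa>. removes_rim_hook p \<nu> \<kappa>))"

end

theory Submission imports Defs begin

text \<open>Encode a partition by its bead set \<open>{\<mu>\<^sub>i - i}\<close> in the integers; removing a rim hook of length \<open>p\<close>
  moves one bead from \<open>x\<close> to a free place \<open>x - p\<close>. Modulo 2, removing two \<open>p\<close>-hooks in all possible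
  ways is the same as removing one \<open>2p\<close>-hook, so the number of tableaux is congruent to the sum of
  these numbers over all partitions obtained by removing one \<open>2\<^sup>k\<close>-hook, as long as \<open>2\<^sup>k\<close> is at most
  the size. If \<open>2\<^sup>k\<close> is the leading binary digit of the size, there is at most one such hook, and the
  partition is odd if and only if the hook exists and stripping it leaves an odd partition.

  As long as the leading digit does not change, stripping induces a bijection between the odd
  partitions covering \<open>\<mu>\<close> and those covering the stripped \<open>\<mu>\<close>, and it is injective on odd partitions
  covered by \<open>\<mu>\<close>; the latter gives the uniqueness of odd parents. Stripping all digits from \<open>2\<^sup>v\<close>
  upwards yields the \<open>2\<^sup>v\<close>-core, and the local bijections assemble to the isomorphism of trees.\<close>

section \<open>Partitions as bead sets\<close>

text \<open>Divisibility of \<open>n\<close> by \<open>2 ^ v\<close> prevents carries: from size n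
  to n + 2^v - 1 only the binary digits below 2^v vary, so the digits to be stripped are the same
  throughout the tree. The obstacle is a box that meets the hook being stripped. Below size 2p at
  most one bead can move down by p and there is no hook of length 2p, so a box interferes only by
  sitting on that bead or by filling the place it would move to; relabelling the box with
  \<open>box_shift\<close> repairs both cases. At size 2^k a parent has a smaller leading digit and
  this comparison fails, so uniqueness of odd parents needs a separate argument there. Finally,
  \<open>core\<close> allows any removals of length 2^v, while stripping removes hooks of length 2^k
  with k at least v; confluence of bead moves and the splitting of a long move into short ones
  reconcile the two.\<close>

definition row :: "nat list \<Rightarrow> nat \<Rightarrow> nat" where
  "row \<mu> i = (if i < length \<mu> then \<mu> ! i else 0)"

lemma diagram_row: "diagram \<mu> = {(i, j). j < row \<mu> i}"
  by (auto simp: diagram_def row_def split: if_splits)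

lemma diagram_Sigma: "diagram \<mu> = (SIGMA i:{..<length \<mu>}. {..<\<mu> ! i})"
  by (auto simp: diagram_def)

lemma finite_diagram [simp]: "finite (diagram \<mu>)"
  by (simp add: diagram_Sigma)

lemma card_diagram: "card (diagram \<mu>) = sum_list \<mu>"
  by (simp add: diagram_Sigma sum_list_sum_nth atLeast0LessThan)

lemma row_antimono:
  assumes "is_partition \<mu>" "i \<le> j"
  shows "row \<mu> j \<le> row \<mu> i"
proof (cases "i = j \<or> j \<ge> length \<mu>")
  case True
  then show ?thesis by (auto simp: row_def)
next
  case False
  then have "i < j" "j < length \<mu>" using assms by auto
  then show ?thesis
    using assms by (auto simp: row_def is_partition_def sorted_wrt_iff_nth_less)
qed

lemma row_pos_iff:
  assumes "is_partition \<mu>"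
  shows "row \<mu> i > 0 \<longleftrightarrow> i < length \<mu>"
  using assms by (auto simp: row_def is_partition_def in_set_conv_nth)

lemma row_inject:
  assumes "is_partition \<mu>" "is_partition \<nu>" "row \<mu> = row \<nu>"
  shows "\<mu> = \<nu>"
proof (rule nth_equalityI)
  have "\<And>i. i < length \<mu> \<longleftrightarrow> i < length \<nu>"
    using row_pos_iff assms by metis
  then show l: "length \<mu> = length \<nu>" by (meson linorder_neq_iff)
  fix i assume "i < length \<mu>"
  then show "\<mu> ! i = \<nu> ! i"
    using fun_cong[OF assms(3), of i] l by (simp add: row_def)
qed

lemma diagram_inject:
  assumes "is_partition \<mu>" "is_partition \<nu>" "diagram \<mu> = diagram \<nu>"
  shows "\<mu> = \<nu>"
proof (rule row_inject[OF assms(1,2)], rule ext)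
  fix i
  have "j < row \<mu> i \<longleftrightarrow> j < row \<nu> i" for j
    using assms(3) by (auto simp: diagram_row set_eq_iff)
  then show "row \<mu> i = row \<nu> i" by (meson linorder_neq_iff)
qed

lemma contained_in_row: "contained_in \<mu> \<nu> \<longleftrightarrow> (\<forall>i. row \<mu> i \<le> row \<nu> i)"
proof
  assume c: "contained_in \<mu> \<nu>"
  show "\<forall>i. row \<mu> i \<le> row \<nu> i"
  proof (rule allI, rule ccontr)
    fix i assume "\<not> row \<mu> i \<le> row \<nu> i"
    then have "(i, row \<nu> i) \<in> diagram \<mu>" by (simp add: diagram_row)
    with c have "(i, row \<nu> i) \<in> diagram \<nu>" by (auto simp: contained_in_def)
    then show False by (simp add: diagram_row)
  qed
qed (auto simp: contained_in_def diagram_row intro: less_le_trans)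

lemma contained_in_size:
  assumes "contained_in \<nu> \<mu>"
  shows "sum_list \<nu> + card (diagram \<mu> - diagram \<nu>) = sum_list \<mu>"
proof -
  have "card (diagram \<nu>) \<le> card (diagram \<mu>)"
    using assms by (intro card_mono) (auto simp: contained_in_def)
  then show ?thesis
    using assms by (simp add: contained_in_def card_Diff_subset flip: card_diagram)
qed

text \<open>Subtracting \<open>i\<close> turns weakly decreasing rows into strictly decreasing
  integers, so the set alone remembers the order. The zero rows are kept: they fill all places far
  below, and no number of rows has to be chosen.\<close>

definition bead :: "nat list \<Rightarrow> nat \<Rightarrow> int" where
  "bead \<mu> i = int (row \<mu> i) - int i"

definition beads :: "nat list \<Rightarrow> int set" where
  "beads \<mu> = range (bead \<mu>)"

lemma bead_less:
  assumes "is_partition \<mu>" "i < j"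
  shows "bead \<mu> j < bead \<mu> i"
  using row_antimono[OF assms(1), of i j] assms(2) by (simp add: bead_def)

text \<open>If all earlier values agree, \<open>u i\<close> must occur in \<open>w\<close> at an
  index not below \<open>i\<close>, so \<open>u i \<le> w i\<close>; exchanging the roles gives
  equality.\<close>

lemma strict_decreasing_range_unique:
  fixes g h :: "nat \<Rightarrow> int"
  assumes g: "\<And>i j. i < j \<Longrightarrow> g j < g i" and h: "\<And>i j. i < j \<Longrightarrow> h j < h i"
    and range: "range g = range h"
  shows "g = h"
proof
  have le: "u i \<le> w i"
    if uw: "\<And>i j. i < j \<Longrightarrow> u j < u i" "\<And>i j. i < j \<Longrightarrow> w j < w i" "range u = range w"
      "\<And>k. k < i \<Longrightarrow> u k = w k" for u w :: "nat \<Rightarrow> int" and i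
  proof -
    obtain k where k: "u i = w k" using uw(3) by blast
    then have "\<not> k < i" using uw(1)[of k i] uw(4)[of k] by force
    then show ?thesis using uw(2)[of i k] k by (cases "i = k") auto
  qed
  fix i show "g i = h i"
  proof (induction i rule: less_induct)
    case (less i)
    show ?case
      using le[of g h i] le[of h g i] less assms by (auto intro!: antisym)
  qed
qed

lemma beads_inject:
  assumes "is_partition \<mu>" "is_partition \<nu>" "beads \<mu> = beads \<nu>"
  shows "\<mu> = \<nu>"
proof (rule row_inject[OF assms(1,2)], rule ext)
  have "bead \<mu> = bead \<nu>"
    using assms by (intro strict_decreasing_range_unique) (auto simp: bead_less beads_def)
  from fun_cong[OF this] show "row \<mu> i = row \<nu> i" for i
    by (simp add: bead_def)
qed

lemma ex_partition_row:
  assumes anti: "\<And>i. f (Suc i) \<le> f i" and zero: "f L = 0"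
  obtains \<mu> where "is_partition \<mu>" "row \<mu> = f"
proof
  \<comment> \<open>The cut is at the first zero and not at \<open>L\<close>, since a partition has
    no part 0.\<close>
  define m where "m = (LEAST n. f n = 0)"
  have m: "f m = 0" and pos: "\<And>i. i < m \<Longrightarrow> f i > 0"
    using zero unfolding m_def by (auto intro: LeastI dest: not_less_Least)
  have mono: "f j \<le> f i" if "i \<le> j" for i j
    using anti lift_Suc_antimono_le that by blast
  show "is_partition (map f [0..<m])"
    using mono pos by (force simp: is_partition_def sorted_wrt_iff_nth_less)
  show "row (map f [0..<m]) = f"
  proof
    show "row (map f [0..<m]) i = f i" for i
      using m mono[of m i] by (cases "i < m") (simp_all add: row_def)
  qed
qed

text \<open>For integers, strict decrease of \<open>g\<close> is weak decrease of
  \<open>g i + int i\<close>; the latter is eventually 0, hence nonnegative, and gives the row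
  lengths.\<close>

lemma ex_partition_bead:
  fixes g :: "nat \<Rightarrow> int"
  assumes dec: "\<And>i. g (Suc i) < g i" and ev: "\<And>i. i \<ge> L \<Longrightarrow> g i = - int i"
  obtains \<mu> where "is_partition \<mu>" "bead \<mu> = g"
proof -
  define h where "h i = g i + int i" for i
  have h: "h (Suc i) \<le> h i" for i using dec[of i] by (simp add: h_def)
  have nonneg: "h i \<ge> 0" for i
  proof -
    have "h (max i L) \<le> h i" by (rule lift_Suc_antimono_le[of h, OF h]) simp
    then show ?thesis using ev[of "max i L"] by (simp add: h_def)
  qed
  obtain \<mu> where "is_partition \<mu>" "row \<mu> = (\<lambda>i. nat (h i))"
  proof (rule ex_partition_row)
    show "nat (h (Suc i)) \<le> nat (h i)" for i using h by (simp add: nat_mono)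
    show "nat (h L) = 0" using ev by (simp add: h_def)
  qed
  then have "bead \<mu> = g"
    using nonneg by (auto simp: bead_def fun_eq_iff h_def)
  with \<open>is_partition \<mu>\<close> show ?thesis by (rule that)
qed

text \<open>Removing a rim hook that occupies the rows from \<open>a\<close> to \<open>b\<close> moves the bead of row \<open>a\<close> down by
  \<open>p\<close> past the beads of the other rows, which shifts the enumeration.\<close>

definition slide :: "nat \<Rightarrow> nat \<Rightarrow> nat \<Rightarrow> (nat \<Rightarrow> int) \<Rightarrow> (nat \<Rightarrow> int) \<Rightarrow> bool" where
  "slide a b p g h \<longleftrightarrow> a \<le> b \<and> h b = g a - int p \<and>
     (\<forall>i. a \<le> i \<and> i < b \<longrightarrow> h i = g (Suc i)) \<and> (\<forall>i. i < a \<or> b < i \<longrightarrow> h i = g i)"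

definition bead_move :: "nat \<Rightarrow> int \<Rightarrow> int set \<Rightarrow> int set" where
  "bead_move p x X = insert (x - int p) (X - {x})"

text \<open>Every bead except \<open>g a\<close> reappears in \<open>h\<close> at an index other
  than \<open>b\<close>. As \<open>h\<close> is injective, \<open>h b\<close> is none of them, so
  the target place is free.\<close>

lemma slide_bead_move:
  assumes g: "\<And>i j. i < j \<Longrightarrow> g j < g i" and h: "\<And>i j. i < j \<Longrightarrow> h j < h i"
    and s: "slide a b p g h" and p: "p > 0"
  shows "g a - int p \<notin> range g" "range h = bead_move p (g a) (range g)"
proof -
  note sd = s[unfolded slide_def]
  have cover: "g k \<in> h ` (UNIV - {b})" if ka: "k \<noteq> a" for k
  proof -
    consider "k < a" | "b < k" | "a < k" "k \<le> b" using ka by linarith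
    then show ?thesis
    proof cases
      case 3
      then have "g k = h (k - 1)" using sd by (cases k) auto
      moreover have "k - 1 \<noteq> b" using 3 by auto
      ultimately show ?thesis by blast
    next
      case 1
      then have "g k = h k" "k \<noteq> b" using sd by auto
      then show ?thesis by blast
    next
      case 2
      then have "g k = h k" "k \<noteq> b" using sd by auto
      then show ?thesis by blast
    qed
  qed
  have inj: "h i = h j \<longleftrightarrow> i = j" for i j by (metis h less_irrefl linorder_neqE_nat)
  have injg: "g i = g j \<longleftrightarrow> i = j" for i j by (metis g less_irrefl linorder_neqE_nat)
  show notin: "g a - int p \<notin> range g"
  proof
    assume "g a - int p \<in> range g"
    then obtain k where k: "g a - int p = g k" by blast
    then have "k \<noteq> a" using p by auto
    moreover have "h b = g k" using sd k by simp
    ultimately show False using cover[of k] inj by auto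
  qed
  have 1: "h i \<in> range g - {g a}" if ib: "i \<noteq> b" for i
  proof -
    consider "i < a" | "b < i" | "a \<le> i" "i < b" using ib by linarith
    then obtain k where "h i = g k" "k \<noteq> a"
    proof cases
      case 3
      then show ?thesis using sd that[of "Suc i"] by simp
    qed (use sd that[of i] in auto)
    then show ?thesis by (simp add: injg)
  qed
  show "range h = bead_move p (g a) (range g)"
    unfolding bead_move_def
  proof (intro equalityI subsetI)
    fix y assume "y \<in> range h"
    then obtain i where "y = h i" by blast
    then show "y \<in> insert (g a - int p) (range g - {g a})"
      using 1[of i] conjunct1[OF conjunct2[OF sd]] by (cases "i = b") simp_all
  next
    fix y assume "y \<in> insert (g a - int p) (range g - {g a})"
    then consider "y = h b" | k where "y = g k" "k \<noteq> a" using sd by auto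
    then show "y \<in> range h" using cover by cases auto
  qed
qed

text \<open>The differences telescope. Since they count the removed cells row by row, the
  displacement of the one moved bead is the hook length.\<close>

lemma slide_sum:
  assumes "slide a b p g h"
  shows "(\<Sum>i=a..b. g i - h i) = int p"
proof -
  have s: "a \<le> b" "h b = g a - int p" "\<And>i. a \<le> i \<Longrightarrow> i < b \<Longrightarrow> h i = g (Suc i)"
    using assms by (auto simp: slide_def)
  have "{a..b} = insert b {a..<b}" using s(1) by auto
  then have "(\<Sum>i=a..b. g i - h i) = g b - h b + (\<Sum>i=a..<b. g i - h i)" by simp
  also have "(\<Sum>i=a..<b. g i - h i) = (\<Sum>i=a..<b. g i - g (Suc i))"
    using s by (intro sum.cong) auto
  also have "\<dots> = - (\<Sum>i=a..<b. g (Suc i) - g i)"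
    by (simp add: sum_negf[symmetric])
  also have "\<dots> = g a - g b" using s(1) by (simp add: sum_Suc_diff')
  finally show ?thesis using s by simp
qed

lemma card_diagram_Diff:
  assumes "\<And>i. row \<nu> i \<le> row \<mu> i" "\<And>i. i < a \<or> b < i \<Longrightarrow> row \<nu> i = row \<mu> i"
  shows "int (card (diagram \<mu> - diagram \<nu>)) = (\<Sum>i=a..b. bead \<mu> i - bead \<nu> i)"
proof -
  have "diagram \<mu> - diagram \<nu> = (SIGMA i:{a..b}. {row \<nu> i..<row \<mu> i})"
    using assms(2) by (force simp: diagram_row not_less)
  then have "card (diagram \<mu> - diagram \<nu>) = (\<Sum>i=a..b. row \<mu> i - row \<nu> i)" by simp
  then show ?thesis using assms(1) by (simp add: of_nat_diff bead_def)
qed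

lemma sym_adjacent_cells: "adjacent_cells a b \<Longrightarrow> adjacent_cells b a"
  by (cases a; cases b) auto

text \<open>Walk left to the first removed cell of a row. Its column is that of the last removed
  cell one row below, because \<open>row \<mu> (Suc i) = Suc (row \<nu> i)\<close>, so a step down
  is possible. All cells reach the lower left end of the hook.\<close>

lemma slide_connected:
  assumes \<mu>: "is_partition \<mu>" and \<nu>: "is_partition \<nu>" and s: "slide a b p (bead \<mu>) (bead \<nu>)"
  shows "connected_cells (diagram \<mu> - diagram \<nu>)"
proof -
  define S where "S = diagram \<mu> - diagram \<nu>"
  define R where "R = {(x, y). x \<in> S \<and> y \<in> S \<and> adjacent_cells x y}"
  have S: "(i, j) \<in> S \<longleftrightarrow> row \<nu> i \<le> j \<and> j < row \<mu> i" for i j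
    by (auto simp: S_def diagram_row)
  have sd: "a \<le> b" "\<And>i. a \<le> i \<Longrightarrow> i < b \<Longrightarrow> Suc (row \<nu> i) = row \<mu> (Suc i)"
    "\<And>i. i < a \<or> b < i \<Longrightarrow> row \<nu> i = row \<mu> i"
    using s by (auto simp: slide_def bead_def)
  have sym: "sym (R\<^sup>*)"
    by (rule sym_rtrancl) (auto simp: R_def sym_def sym_adjacent_cells)
  have left: "((i, j), (i, row \<nu> i)) \<in> R\<^sup>*" if "(i, j) \<in> S" for i j
  proof -
    have "row \<nu> i \<le> j" using that S by auto
    then show ?thesis using that
    proof (induction j rule: dec_induct)
      case (step k)
      then have "(i, k) \<in> S" "((i, Suc k), (i, k)) \<in> R" by (auto simp: S R_def)
      then show ?case using step by (meson converse_rtrancl_into_rtrancl)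
    qed simp
  qed
  have down: "((i, j), (b, row \<nu> b)) \<in> R\<^sup>*" if "(i, j) \<in> S" for i j
  proof -
    have "i \<le> b" "a \<le> i" using that sd(3)[of i] S by (force simp: not_less)+
    then show ?thesis using that
    proof (induction i arbitrary: j rule: inc_induct)
      case base
      then show ?case using left by blast
    next
      case (step i)
      have e: "Suc (row \<nu> i) = row \<mu> (Suc i)" using sd(2) step by simp
      have "row \<nu> (Suc i) \<le> row \<nu> i" using row_antimono[OF \<nu>, of i "Suc i"] by simp
      then have 1: "(Suc i, row \<nu> i) \<in> S" using e by (auto simp: S)
      have 2: "(i, row \<nu> i) \<in> S" using step S by force
      have "((i, row \<nu> i), (Suc i, row \<nu> i)) \<in> R" using 1 2 by (auto simp: R_def)
      with left[OF step.prems(2)] step.IH[OF _ 1] step.prems(1) show ?case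
        by (meson le_SucI rtrancl.rtrancl_into_rtrancl rtrancl_trans)
    qed
  qed
  have "(x, y) \<in> R\<^sup>*" if "x \<in> S" "y \<in> S" for x y
    using down that sym by (metis prod.collapse rtrancl_trans symD)
  then show ?thesis unfolding connected_cells_def R_def S_def by blast
qed

lemma bead_move_removes_rim_hook:
  assumes \<mu>: "is_partition \<mu>" and p: "p > 0" and x: "x \<in> beads \<mu>" "x - int p \<notin> beads \<mu>"
  obtains \<nu> where "removes_rim_hook p \<mu> \<nu>" "beads \<nu> = bead_move p x (beads \<mu>)"
proof -
  obtain a where a: "x = bead \<mu> a" using x(1) by (auto simp: beads_def)
  \<comment> \<open>A bound for the rows whose bead lies above the target: an empty row
    \<open>i\<close> has bead \<open>- int i\<close>, which exceeds \<open>x - int p\<close> only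
    for \<open>int i < int p - x\<close>.\<close>
  define L where "L = Suc (length \<mu> + a + nat (int p - x))"
  have far: "bead \<mu> i = - int i" if "i \<ge> length \<mu>" for i
    using that by (simp add: bead_def row_def)
  have inL: "i < L" if "bead \<mu> i > x - int p" for i
    using that far[of i] by (cases "i < length \<mu>") (auto simp: L_def)
  have fin: "finite {i. bead \<mu> i > x - int p}"
    by (rule finite_subset[of _ "{..<L}"]) (blast dest: inL, simp)
  \<comment> \<open>The moved bead is inserted behind the last bead above its target; that row
    becomes the bottom row of the hook.\<close>
  define b where "b = Max {i. bead \<mu> i > x - int p}"
  have "a \<in> {i. bead \<mu> i > x - int p}" using a p by simp
  then have ab: "a \<le> b" and bb: "bead \<mu> b > x - int p"
    using fin Max_in[of "{i. bead \<mu> i > x - int p}"] by (auto simp: b_def)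
  have after: "bead \<mu> i < x - int p" if "b < i" for i
  proof -
    have "\<not> bead \<mu> i > x - int p" using that fin by (auto simp: b_def dest: Max_ge)
    moreover have "bead \<mu> i \<noteq> x - int p" using x(2) by (metis beads_def rangeI)
    ultimately show ?thesis by simp
  qed
  have bL: "b < L" using bb by (rule inL)
  define g where "g i = (if i < a \<or> b < i then bead \<mu> i else if i < b then bead \<mu> (Suc i)
     else x - int p)" for i
  have dec: "bead \<mu> (Suc i) < bead \<mu> i" for i using bead_less[OF \<mu>] by simp
  have gle: "g i \<le> bead \<mu> i" for i
  proof -
    consider "i < a \<or> b < i" | "a \<le> i" "i < b" | "i = b" by linarith
    then show ?thesis using dec[of i] bb ab by cases (simp_all add: g_def)
  qed
  obtain \<nu> where \<nu>: "is_partition \<nu>" "bead \<nu> = g"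
  proof (rule ex_partition_bead[where g = g and L = L])
    fix i
    consider "Suc i < a" | "Suc i = a" | "a \<le> i" "Suc i < b" | "a \<le> i" "Suc i = b" | "i = b" | "b < i"
      using ab by linarith
    then show "g (Suc i) < g i"
    proof cases
      case 2
      then have "g i = bead \<mu> i" by (simp add: g_def)
      then show ?thesis using gle[of "Suc i"] dec[of i] by simp
    qed (use dec bb after ab in \<open>auto simp: g_def\<close>)
  next
    fix i assume "L \<le> i"
    moreover have "length \<mu> \<le> L" by (simp add: L_def)
    ultimately show "g i = - int i" using bL far[of i] by (simp add: g_def)
  qed
  have s: "slide a b p (bead \<mu>) (bead \<nu>)"
    using ab a by (auto simp: slide_def \<nu> g_def)
  have row_le: "row \<nu> i \<le> row \<mu> i" for i
    using gle[of i] by (simp add: bead_def flip: \<nu>(2))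
  have row_eq: "row \<nu> i = row \<mu> i" if "i < a \<or> b < i" for i
    using s that by (auto simp: slide_def bead_def)
  have card: "card (diagram \<mu> - diagram \<nu>) = p"
    using card_diagram_Diff[OF row_le, of a b] row_eq slide_sum[OF s] by simp
  have rim: "diagram \<mu> - diagram \<nu> \<subseteq> rim \<mu>"
  proof
    fix c assume c: "c \<in> diagram \<mu> - diagram \<nu>"
    obtain i j where ij: "c = (i, j)" by force
    with c have j: "row \<nu> i \<le> j" "j < row \<mu> i" by (auto simp: diagram_row)
    with row_eq[of i] have i: "a \<le> i" "i \<le> b" by force+
    \<comment> \<open>This bound puts the cell diagonally below \<open>c\<close> outside
      \<open>diagram \<mu>\<close>.\<close>
    have "row \<mu> (Suc i) \<le> Suc (row \<nu> i)"
    proof (cases "i = b")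
      case True
      then have "bead \<mu> (Suc i) < bead \<nu> i" using after[of "Suc b"] ab by (simp add: \<nu> g_def)
      then show ?thesis by (simp add: bead_def)
    next
      case False
      then have "bead \<nu> i = bead \<mu> (Suc i)" using s i by (auto simp: slide_def)
      then show ?thesis by (simp add: bead_def)
    qed
    then show "c \<in> rim \<mu>" using j ij by (auto simp: rim_def diagram_row)
  qed
  have "removes_rim_hook p \<mu> \<nu>"
    unfolding removes_rim_hook_def
    using \<mu> \<nu>(1) row_le rim card slide_connected[OF \<mu> \<nu>(1) s] by (simp add: contained_in_row)
  moreover have "beads \<nu> = bead_move p x (beads \<mu>)"
    using slide_bead_move(2)[OF bead_less[OF \<mu>] bead_less[OF \<nu>(1)] s p] by (simp add: beads_def a)
  ultimately show ?thesis by (rule that)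
qed

lemma rtrancl_crossing:
  assumes "(x, y) \<in> R\<^sup>*" "P x" "\<not> P y"
  obtains u w where "(u, w) \<in> R" "P u" "\<not> P w"
  using assms by (induction rule: rtrancl_induct) blast+

text \<open>Between consecutive rows of the hook, connectedness forces a common column of removed
  cells, and lying on the rim allows at most one. Overlap in exactly one column is the equation that
  \<open>slide\<close> demands.\<close>

lemma removes_rim_hook_bead_move:
  assumes r: "removes_rim_hook p \<mu> \<nu>" and p: "p > 0"
  obtains x where "x \<in> beads \<mu>" "x - int p \<notin> beads \<mu>" "beads \<nu> = bead_move p x (beads \<mu>)"
proof -
  define S where "S = diagram \<mu> - diagram \<nu>"
  have \<mu>: "is_partition \<mu>" and \<nu>: "is_partition \<nu>" and le: "\<And>i. row \<nu> i \<le> row \<mu> i"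
    and rim: "S \<subseteq> rim \<mu>" and con: "connected_cells S" and card: "card S = p"
    using r by (auto simp: removes_rim_hook_def S_def contained_in_row)
  have S: "(i, j) \<in> S \<longleftrightarrow> row \<nu> i \<le> j \<and> j < row \<mu> i" for i j
    by (auto simp: S_def diagram_row)
  have fin: "finite (fst ` S)" "fst ` S \<noteq> {}" using card p by (auto simp: S_def card_gt_0_iff)
  define a b where "a = Min (fst ` S)" and "b = Max (fst ` S)"
  have ab: "a \<in> fst ` S" "b \<in> fst ` S" "a \<le> b"
    using fin by (auto simp: a_def b_def simp del: Min_le_iff Max_ge_iff)
  have out: "row \<nu> i = row \<mu> i" if "i < a \<or> b < i" for i
  proof (rule ccontr)
    assume "row \<nu> i \<noteq> row \<mu> i"
    with le[of i] have "(i, row \<nu> i) \<in> S" by (simp add: S)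
    then have "i \<in> fst ` S" by force
    then show False using that fin unfolding a_def b_def by (metis Max_ge Min_le not_le)
  qed
  have mid: "row \<mu> (Suc i) = Suc (row \<nu> i)" if i: "a \<le> i" "i < b" for i
  proof -
    obtain ca cb where c: "ca \<in> S" "fst ca = a" "cb \<in> S" "fst cb = b" using ab by blast
    then have "(ca, cb) \<in> {(x, y). x \<in> S \<and> y \<in> S \<and> adjacent_cells x y}\<^sup>*"
      using con by (auto simp: connected_cells_def)
    then obtain u w where uw: "u \<in> S" "w \<in> S" "adjacent_cells u w" "fst u \<le> i" "\<not> fst w \<le> i"
      by (rule rtrancl_crossing[where P = "\<lambda>z. fst z \<le> i"]) (use c i in auto)
    then obtain j where "u = (i, j)" "w = (Suc i, j)"
      by (cases u; cases w) auto
    then have "Suc (row \<nu> i) \<le> row \<mu> (Suc i)" "(i, row \<nu> i) \<in> S"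
      using uw by (auto simp: S)
    moreover from this(2) rim have "row \<mu> (Suc i) \<le> Suc (row \<nu> i)"
      by (auto simp: rim_def diagram_row)
    ultimately show ?thesis by simp
  qed
  \<comment> \<open>The displacement is first taken to be whatever makes \<open>slide\<close> true;
    counting cells then identifies it with \<open>p\<close>.\<close>
  define d where "d = nat (bead \<mu> a - bead \<nu> b)"
  have "bead \<nu> b \<le> bead \<mu> a"
    using le[of b] row_antimono[OF \<mu> ab(3)] ab(3) by (simp add: bead_def)
  then have s: "slide a b d (bead \<mu>) (bead \<nu>)"
    using ab out mid by (auto simp: slide_def d_def bead_def)
  have "d = p"
    using slide_sum[OF s] card_diagram_Diff[OF le, of a b] out card by (simp add: S_def)
  with s have "slide a b p (bead \<mu>) (bead \<nu>)" by simp
  from slide_bead_move[OF bead_less[OF \<mu>] bead_less[OF \<nu>] this p] that[of "bead \<mu> a"]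
  show ?thesis by (simp add: beads_def)
qed

section \<open>Covers and standard tableaux\<close>

lemma diagram_down_closed:
  assumes "is_partition \<mu>" "(i, j) \<in> diagram \<mu>" "i' \<le> i" "j' \<le> j"
  shows "(i', j') \<in> diagram \<mu>"
  using assms row_antimono[OF assms(1,3)] by (simp add: diagram_row)

lemma remove_corner:
  assumes \<mu>: "is_partition \<mu>" and i: "row \<mu> (Suc i) < row \<mu> i"
  obtains \<kappa> where "is_partition \<kappa>" "diagram \<kappa> = diagram \<mu> - {(i, row \<mu> i - 1)}"
proof -
  obtain \<kappa> where \<kappa>: "is_partition \<kappa>" "row \<kappa> = (row \<mu>)(i := row \<mu> i - 1)"
  proof (rule ex_partition_row)
    show "((row \<mu>)(i := row \<mu> i - 1)) (Suc k) \<le> ((row \<mu>)(i := row \<mu> i - 1)) k" for k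
      using row_antimono[OF \<mu>, of k "Suc k"] i by auto
    show "((row \<mu>)(i := row \<mu> i - 1)) (length \<mu>) = 0"
      by (simp add: row_def)
  qed
  moreover have "diagram \<kappa> = diagram \<mu> - {(i, row \<mu> i - 1)}"
    unfolding diagram_row \<kappa>(2) by (auto split: if_splits)
  ultimately show ?thesis using that by blast
qed

lemma remove_cell_removes_rim_hook:
  assumes "is_partition \<mu>" "is_partition \<kappa>" "c \<in> diagram \<mu>" "diagram \<kappa> = diagram \<mu> - {c}"
  shows "removes_rim_hook 1 \<mu> \<kappa>"
proof -
  have d: "diagram \<mu> - diagram \<kappa> = {c}" using assms by auto
  obtain i j where c: "c = (i, j)" by force
  have "(Suc i, Suc j) \<notin> diagram \<mu>"
  proof
    assume "(Suc i, Suc j) \<in> diagram \<mu>"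
    then have "(Suc i, Suc j) \<in> diagram \<kappa>" using assms c by auto
    then have "(i, j) \<in> diagram \<kappa>"
      by (rule diagram_down_closed[OF assms(2)]) auto
    then show False using assms c by auto
  qed
  then have "{c} \<subseteq> rim \<mu>" using assms(3) c by (auto simp: rim_def)
  then show ?thesis
    using assms unfolding removes_rim_hook_def d
    by (auto simp: contained_in_def connected_cells_def)
qed

lemma young_covers_iff_remove_cell:
  "young_covers \<kappa> \<mu> \<longleftrightarrow> is_partition \<kappa> \<and> is_partition \<mu> \<and>
     (\<exists>c\<in>diagram \<mu>. diagram \<kappa> = diagram \<mu> - {c})"
proof
  assume yc: "young_covers \<kappa> \<mu>"
  then have \<kappa>: "is_partition \<kappa>" and \<mu>: "is_partition \<mu>" and le: "\<And>i. row \<kappa> i \<le> row \<mu> i"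
    and ne: "\<kappa> \<noteq> \<mu>" by (auto simp: young_covers_def contained_in_row)
  define A where "A = {i. row \<kappa> i < row \<mu> i}"
  have "A \<subseteq> {..<length \<mu>}" 
  proof
    fix i assume "i \<in> A"
    then show "i \<in> {..<length \<mu>}" using row_pos_iff[OF \<mu>, of i] by (simp add: A_def)
  qed
  then have fin: "finite A" by (rule finite_subset) simp
  have "A \<noteq> {}"
  proof
    assume "A = {}"
    then have "\<not> row \<kappa> i < row \<mu> i" for i by (auto simp: A_def)
    then have "row \<kappa> = row \<mu>" using le by (intro ext) (meson antisym not_less)
    then show False using row_inject[OF \<kappa> \<mu>] ne by auto
  qed
  \<comment> \<open>In the lowest row where the shapes differ, \<open>\<mu>\<close> has a corner:
    the next row is shared with \<open>\<kappa>\<close>, whose rows decrease. Removing that corner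
    gives a partition between the two, which must be \<open>\<kappa>\<close>.\<close>
  define i where "i = Max A"
  have "i \<in> A" "Suc i \<notin> A"
    using fin \<open>A \<noteq> {}\<close> by (auto simp: i_def dest: Max_ge)
  then have "row \<kappa> i < row \<mu> i" "row \<kappa> (Suc i) = row \<mu> (Suc i)"
    using le[of "Suc i"] by (auto simp: A_def)
  moreover have "row \<kappa> (Suc i) \<le> row \<kappa> i" using row_antimono[OF \<kappa>] by simp
  ultimately have i: "row \<mu> (Suc i) < row \<mu> i" "row \<kappa> i < row \<mu> i" by auto
  obtain \<nu> where \<nu>: "is_partition \<nu>" "diagram \<nu> = diagram \<mu> - {(i, row \<mu> i - 1)}"
    using remove_corner[OF \<mu> i(1)] by blast
  have c: "(i, row \<mu> i - 1) \<in> diagram \<mu>" "(i, row \<mu> i - 1) \<notin> diagram \<kappa>"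
    using i by (auto simp: diagram_row)
  then have "contained_in \<kappa> \<nu>" "contained_in \<nu> \<mu>" "\<nu> \<noteq> \<mu>"
    using \<nu> yc by (auto simp: contained_in_def young_covers_def)
  then have "\<nu> = \<kappa>" using yc \<nu>(1) by (auto simp: young_covers_def)
  then show "is_partition \<kappa> \<and> is_partition \<mu> \<and> (\<exists>c\<in>diagram \<mu>. diagram \<kappa> = diagram \<mu> - {c})"
    using \<kappa> \<mu> \<nu> c by auto
next
  assume "is_partition \<kappa> \<and> is_partition \<mu> \<and> (\<exists>c\<in>diagram \<mu>. diagram \<kappa> = diagram \<mu> - {c})"
  then obtain c where *: "is_partition \<kappa>" "is_partition \<mu>" "c \<in> diagram \<mu>"
    "diagram \<kappa> = diagram \<mu> - {c}" by blast
  have "\<nu> = \<kappa> \<or> \<nu> = \<mu>" if "is_partition \<nu>" "contained_in \<kappa> \<nu>" "contained_in \<nu> \<mu>" for \<nu>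
  proof -
    have "diagram \<nu> = diagram \<kappa> \<or> diagram \<nu> = diagram \<mu>"
      using that *(4) by (auto simp: contained_in_def)
    then show ?thesis using diagram_inject *(1,2) that(1) by blast
  qed
  then show "young_covers \<kappa> \<mu>"
    using * by (auto simp: young_covers_def contained_in_def)
qed

lemma young_covers_iff_removes_rim_hook: "young_covers \<kappa> \<mu> \<longleftrightarrow> removes_rim_hook 1 \<mu> \<kappa>"
proof
  assume "young_covers \<kappa> \<mu>"
  then show "removes_rim_hook 1 \<mu> \<kappa>"
    using remove_cell_removes_rim_hook by (auto simp: young_covers_iff_remove_cell)
next
  assume r: "removes_rim_hook 1 \<mu> \<kappa>"
  then obtain c where "diagram \<mu> - diagram \<kappa> = {c}" "diagram \<kappa> \<subseteq> diagram \<mu>"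
    by (auto simp: removes_rim_hook_def card_1_singleton_iff contained_in_def)
  then have "c \<in> diagram \<mu>" "diagram \<kappa> = diagram \<mu> - {c}" by auto
  then show "young_covers \<kappa> \<mu>"
    using r by (auto simp: young_covers_iff_remove_cell removes_rim_hook_def)
qed

lemma removes_rim_hook_size:
  "removes_rim_hook p \<mu> \<nu> \<Longrightarrow> sum_list \<nu> + p = sum_list \<mu>"
  using contained_in_size by (auto simp: removes_rim_hook_def)

lemma young_covers_size: "young_covers \<kappa> \<mu> \<Longrightarrow> sum_list \<mu> = Suc (sum_list \<kappa>)"
  using removes_rim_hook_size[of 1] by (simp add: young_covers_iff_removes_rim_hook)

lemma finite_young_covers: "finite {\<kappa>. young_covers \<kappa> \<mu>}"
proof (rule finite_imageD)
  show "inj_on diagram {\<kappa>. young_covers \<kappa> \<mu>}"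
    by (rule inj_onI) (auto simp: young_covers_def intro: diagram_inject)
  show "finite (diagram ` {\<kappa>. young_covers \<kappa> \<mu>})"
    by (rule finite_subset[of _ "Pow (diagram \<mu>)"]) (auto simp: young_covers_def contained_in_def)
qed

section \<open>Branching rule for the number of standard tableaux\<close>

lemma finite_standard_tableaux: "finite (standard_tableaux \<mu>)"
proof (rule finite_subset)
  show "standard_tableaux \<mu> \<subseteq> (\<Pi>\<^sub>E c\<in>diagram \<mu>. {1..sum_list \<mu>})"
    by (auto simp: standard_tableaux_def PiE_def bij_betw_def)
  show "finite (\<Pi>\<^sub>E c\<in>diagram \<mu>. {1..sum_list \<mu>})"
    by (intro finite_PiE) auto
qed

lemma standard_tableaux_extend:
  assumes \<mu>: "is_partition \<mu>" and \<kappa>: "is_partition \<kappa>"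
    and c: "c \<in> diagram \<mu>" "diagram \<kappa> = diagram \<mu> - {c}"
    and S: "S \<in> standard_tableaux \<kappa>"
  shows "S(c := sum_list \<mu>) \<in> standard_tableaux \<mu>"
proof -
  let ?n = "sum_list \<mu>" and ?T = "S(c := sum_list \<mu>)"
  have n: "?n = Suc (sum_list \<kappa>)"
    using young_covers_size \<mu> \<kappa> c by (auto simp: young_covers_iff_remove_cell)
  have bij: "bij_betw S (diagram \<kappa>) {1..sum_list \<kappa>}" and ext: "S \<in> extensional (diagram \<kappa>)"
    and R: "\<And>i j j'. (i, j) \<in> diagram \<kappa> \<Longrightarrow> (i, j') \<in> diagram \<kappa> \<Longrightarrow> j < j' \<Longrightarrow> S (i, j) < S (i, j')"
    and C: "\<And>i i' j. (i, j) \<in> diagram \<kappa> \<Longrightarrow> (i', j) \<in> diagram \<kappa> \<Longrightarrow> i < i' \<Longrightarrow> S (i, j) < S (i', j)"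
    using S by (auto simp: standard_tableaux_def)
  have small: "S d < ?n" if "d \<in> diagram \<kappa>" for d
    using bij_betwE[OF bij] that n by force
  have split: "d \<in> diagram \<mu> \<longleftrightarrow> d = c \<or> d \<in> diagram \<kappa>" for d using c by auto
  have cn: "c \<notin> diagram \<kappa>" using c by simp
  have "bij_betw ?T (diagram \<kappa>) {1..sum_list \<kappa>}"
    using bij by (rule bij_betw_cong[THEN iffD1, rotated]) (use cn in auto)
  then have "bij_betw ?T (diagram \<kappa> \<union> {c}) ({1..sum_list \<kappa>} \<union> {?T c})"
    by (rule notIn_Un_bij_betw[OF cn, rotated]) (simp add: n)
  moreover have "diagram \<kappa> \<union> {c} = diagram \<mu>" using c by auto
  moreover have "{1..sum_list \<kappa>} \<union> {?T c} = {1..?n}" using n by auto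
  ultimately have 1: "bij_betw ?T (diagram \<mu>) {1..?n}" by simp
  have 2: "?T (i, j) < ?T (i, j')"
    if "(i, j) \<in> diagram \<mu>" "(i, j') \<in> diagram \<mu>" "j < j'" for i j j'
  proof (cases "(i, j') = c")
    case True
    then show ?thesis using that small split by auto
  next
    case False
    then have "(i, j') \<in> diagram \<kappa>" using that split by auto
    moreover from this have "(i, j) \<in> diagram \<kappa>"
      using that by (auto intro: diagram_down_closed[OF \<kappa>])
    ultimately show ?thesis using R that(3) cn by auto
  qed
  have 3: "?T (i, j) < ?T (i', j)"
    if "(i, j) \<in> diagram \<mu>" "(i', j) \<in> diagram \<mu>" "i < i'" for i i' j
  proof (cases "(i', j) = c")
    case True
    then show ?thesis using that small split by auto
  next
    case False
    then have "(i', j) \<in> diagram \<kappa>" using that split by auto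
    moreover from this have "(i, j) \<in> diagram \<kappa>"
      using that by (auto intro: diagram_down_closed[OF \<kappa>])
    ultimately show ?thesis using C that(3) cn by auto
  qed
  have "?T \<in> extensional (diagram \<mu>)" using ext c by (auto simp: extensional_def)
  then show ?thesis using 1 2 3 by (auto simp: standard_tableaux_def simp del: fun_upd_apply)
qed

lemma standard_tableaux_restrict:
  assumes \<mu>: "is_partition \<mu>" "\<mu> \<noteq> []" and T: "T \<in> standard_tableaux \<mu>"
  obtains \<kappa> c S where "is_partition \<kappa>" "c \<in> diagram \<mu>" "diagram \<kappa> = diagram \<mu> - {c}"
    "S \<in> standard_tableaux \<kappa>" "T = S(c := sum_list \<mu>)"
proof -
  let ?n = "sum_list \<mu>"
  have bij: "bij_betw T (diagram \<mu>) {1..?n}" and ext: "T \<in> extensional (diagram \<mu>)"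
    and R: "\<And>i j j'. (i, j) \<in> diagram \<mu> \<Longrightarrow> (i, j') \<in> diagram \<mu> \<Longrightarrow> j < j' \<Longrightarrow> T (i, j) < T (i, j')"
    and C: "\<And>i i' j. (i, j) \<in> diagram \<mu> \<Longrightarrow> (i', j) \<in> diagram \<mu> \<Longrightarrow> i < i' \<Longrightarrow> T (i, j) < T (i', j)"
    using T by (auto simp: standard_tableaux_def)
  have "?n \<ge> 1" using \<mu> by (cases \<mu>) (auto simp: is_partition_def)
  then have "?n \<in> T ` diagram \<mu>" using bij by (auto simp: bij_betw_def)
  then obtain i j where c: "(i, j) \<in> diagram \<mu>" "T (i, j) = ?n" by force
  have le: "T d \<le> ?n" if "d \<in> diagram \<mu>" for d
    using bij that by (auto simp: bij_betw_def)
  have "(i, Suc j) \<notin> diagram \<mu>" "(Suc i, j) \<notin> diagram \<mu>"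
    using R[OF c(1), of "Suc j"] C[OF c(1), of "Suc i"] le c(2) by (force simp: not_less)+
  then have j: "row \<mu> i = Suc j" "row \<mu> (Suc i) < row \<mu> i"
    using c(1) by (auto simp: diagram_row)
  obtain \<kappa> where \<kappa>: "is_partition \<kappa>" "diagram \<kappa> = diagram \<mu> - {(i, j)}"
    using remove_corner[OF \<mu>(1) j(2)] j(1) by auto
  define S where "S = restrict T (diagram \<kappa>)"
  have n: "?n = Suc (sum_list \<kappa>)"
    using young_covers_size \<mu> \<kappa> c by (auto simp: young_covers_iff_remove_cell)
  have "bij_betw T (diagram \<mu> - {(i, j)}) ({1..?n} - {T (i, j)})"
    using bij c(1) by (intro bij_betw_DiffI) (auto simp: bij_betw_def)
  moreover have "{1..?n} - {T (i, j)} = {1..sum_list \<kappa>}" using c n by auto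
  ultimately have "bij_betw T (diagram \<kappa>) {1..sum_list \<kappa>}" using \<kappa> by simp
  then have "bij_betw S (diagram \<kappa>) {1..sum_list \<kappa>}"
    by (rule bij_betw_cong[THEN iffD1, rotated]) (simp add: S_def)
  then have "S \<in> standard_tableaux \<kappa>"
    using R C \<kappa>(2) by (simp add: standard_tableaux_def S_def)
  moreover have "T = S((i, j) := ?n)"
    using c \<kappa>(2) ext by (auto simp: S_def fun_eq_iff extensional_def)
  ultimately show ?thesis using that \<kappa> c by blast
qed

text \<open>The largest entry sits in a corner, and deleting it leaves a standard tableau of a
  covered shape. The empty shape is different: it covers nothing, yet has one tableau.\<close>

lemma num_syt_rec:
  assumes \<mu>: "is_partition \<mu>" "\<mu> \<noteq> []"
  shows "num_syt \<mu> = (\<Sum>\<kappa> | young_covers \<kappa> \<mu>. num_syt \<kappa>)"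
proof -
  define cell where "cell \<kappa> = (SOME c. c \<in> diagram \<mu> \<and> diagram \<kappa> = diagram \<mu> - {c})" for \<kappa>
  have cell_eq: "cell \<kappa> = c" if "c \<in> diagram \<mu>" "diagram \<kappa> = diagram \<mu> - {c}" for \<kappa> c
  proof -
    have "cell \<kappa> \<in> diagram \<mu> \<and> diagram \<kappa> = diagram \<mu> - {cell \<kappa>}"
      unfolding cell_def using that by (intro someI) auto
    then show ?thesis using that by auto
  qed
  have cell: "cell \<kappa> \<in> diagram \<mu> \<and> diagram \<kappa> = diagram \<mu> - {cell \<kappa>} \<and> is_partition \<kappa>"
    if "young_covers \<kappa> \<mu>" for \<kappa>
    using that cell_eq by (auto simp: young_covers_iff_remove_cell)
  define E where "E \<kappa> = (\<lambda>S. S(cell \<kappa> := sum_list \<mu>)) ` standard_tableaux \<kappa>" for \<kappa>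
  have sub: "E \<kappa> \<subseteq> standard_tableaux \<mu>" if "young_covers \<kappa> \<mu>" for \<kappa>
    unfolding E_def using standard_tableaux_extend[OF \<mu>(1)] cell[OF that] by blast
  have "standard_tableaux \<mu> = (\<Union>\<kappa>\<in>{\<kappa>. young_covers \<kappa> \<mu>}. E \<kappa>)"
  proof (intro equalityI subsetI)
    fix T assume "T \<in> standard_tableaux \<mu>"
    then obtain \<kappa> c S where "is_partition \<kappa>" and c: "c \<in> diagram \<mu>" "diagram \<kappa> = diagram \<mu> - {c}"
      and S: "S \<in> standard_tableaux \<kappa>" "T = S(c := sum_list \<mu>)"
      by (rule standard_tableaux_restrict[OF \<mu>])
    then have "young_covers \<kappa> \<mu>" using \<mu> by (auto simp: young_covers_iff_remove_cell)
    moreover have "T \<in> E \<kappa>" using S cell_eq[OF c] by (auto simp: E_def)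
    ultimately show "T \<in> (\<Union>\<kappa>\<in>{\<kappa>. young_covers \<kappa> \<mu>}. E \<kappa>)" by blast
  qed (use sub in auto)
  moreover have "E \<kappa> \<inter> E \<kappa>' = {}"
    if k: "young_covers \<kappa> \<mu>" "young_covers \<kappa>' \<mu>" "\<kappa> \<noteq> \<kappa>'" for \<kappa> \<kappa>'
  proof (rule ccontr)
    assume "E \<kappa> \<inter> E \<kappa>' \<noteq> {}"
    then obtain T where T: "T \<in> E \<kappa>" "T \<in> E \<kappa>'" by blast
    have "U (cell \<tau>) = sum_list \<mu>" if "U \<in> E \<tau>" for U \<tau>
      using that by (auto simp: E_def)
    from this[OF T(1)] this[OF T(2)] have "T (cell \<kappa>) = sum_list \<mu>" "T (cell \<kappa>') = sum_list \<mu>" .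
    moreover have "inj_on T (diagram \<mu>)"
      using T sub k by (auto simp: standard_tableaux_def bij_betw_def)
    ultimately have "cell \<kappa> = cell \<kappa>'" using cell k by (metis inj_onD)
    then have "diagram \<kappa> = diagram \<kappa>'" using cell k by metis
    then show False using diagram_inject k(3) cell k by blast
  qed
  moreover have "card (E \<kappa>) = num_syt \<kappa>" if "young_covers \<kappa> \<mu>" for \<kappa>
  proof -
    have "inj_on (\<lambda>S. S(cell \<kappa> := sum_list \<mu>)) (standard_tableaux \<kappa>)"
    proof (rule inj_onI, rule ext)
      fix S S' d
      assume S: "S \<in> standard_tableaux \<kappa>" "S' \<in> standard_tableaux \<kappa>"
        and eq: "S(cell \<kappa> := sum_list \<mu>) = S'(cell \<kappa> := sum_list \<mu>)"
      \<comment> \<open>Overwriting loses the value at the removed cell, but extensionality fixes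
        that value to \<open>undefined\<close>.\<close>
      have "cell \<kappa> \<notin> diagram \<kappa>" using cell[OF that] by auto
      then have "S (cell \<kappa>) = undefined" "S' (cell \<kappa>) = undefined"
        using S unfolding standard_tableaux_def by (blast intro: extensional_arb)+
      then show "S d = S' d"
        using fun_cong[OF eq, of d] by (cases "d = cell \<kappa>") auto
    qed
    then show ?thesis by (simp add: E_def card_image num_syt_def)
  qed
  moreover have "finite (E \<kappa>)" for \<kappa> by (simp add: E_def finite_standard_tableaux)
  ultimately have "card (standard_tableaux \<mu>) = (\<Sum>\<kappa> | young_covers \<kappa> \<mu>. num_syt \<kappa>)"
    using finite_young_covers by (simp add: card_UN_disjoint)
  then show ?thesis by (simp add: num_syt_def)
qed

section \<open>Hook removal modulo 2\<close>

text \<open>The Maya diagrams of charge zero, normalised so that \<open>{..0}\<close> is the empty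
  partition.\<close>

definition maya :: "int set set" where
  "maya = beads ` Collect is_partition"

definition shape :: "int set \<Rightarrow> nat list" where
  "shape X = (THE \<mu>. is_partition \<mu> \<and> beads \<mu> = X)"

definition weight :: "int set \<Rightarrow> nat" where
  "weight X = sum_list (shape X)"

definition syt_count :: "int set \<Rightarrow> nat" where
  "syt_count X = num_syt (shape X)"

text \<open>Hooks of length \<open>p\<close> correspond to a bead with a gap \<open>p\<close> places
  below; the bead serves as the name of the hook.\<close>

definition hooks :: "nat \<Rightarrow> int set \<Rightarrow> int set" where
  "hooks p X = {x \<in> X. x - int p \<notin> X}"

lemma shape_beads [simp]: "is_partition \<mu> \<Longrightarrow> shape (beads \<mu>) = \<mu>"
  unfolding shape_def by (rule the_equality) (auto intro: beads_inject)

lemma mayaE: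
  assumes "X \<in> maya"
  obtains \<mu> where "is_partition \<mu>" "X = beads \<mu>" "shape X = \<mu>"
  using assms by (auto simp: maya_def)

lemma removes_rim_hook_iff_bead_move:
  assumes "p > 0"
  shows "removes_rim_hook p \<mu> \<nu> \<longleftrightarrow> is_partition \<mu> \<and> is_partition \<nu> \<and>
    (\<exists>x\<in>hooks p (beads \<mu>). beads \<nu> = bead_move p x (beads \<mu>))"
proof
  assume r: "removes_rim_hook p \<mu> \<nu>"
  from removes_rim_hook_bead_move[OF r assms] r
  show "is_partition \<mu> \<and> is_partition \<nu> \<and>
    (\<exists>x\<in>hooks p (beads \<mu>). beads \<nu> = bead_move p x (beads \<mu>))"
    unfolding hooks_def removes_rim_hook_def by blast
next
  assume "is_partition \<mu> \<and> is_partition \<nu> \<and>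
    (\<exists>x\<in>hooks p (beads \<mu>). beads \<nu> = bead_move p x (beads \<mu>))"
  then obtain x where x: "is_partition \<mu>" "is_partition \<nu>" "x \<in> beads \<mu>" "x - int p \<notin> beads \<mu>"
    "beads \<nu> = bead_move p x (beads \<mu>)" by (auto simp: hooks_def)
  obtain \<nu>' where "removes_rim_hook p \<mu> \<nu>'" "beads \<nu>' = bead_move p x (beads \<mu>)"
    by (rule bead_move_removes_rim_hook[OF x(1) assms x(3,4)])
  moreover from this have "\<nu>' = \<nu>"
    using x(2,5) by (intro beads_inject) (auto simp: removes_rim_hook_def)
  ultimately show "removes_rim_hook p \<mu> \<nu>" by simp
qed

lemma bead_move_maya:
  assumes "X \<in> maya" "p > 0" "x \<in> hooks p X"
  shows "bead_move p x X \<in> maya" "weight (bead_move p x X) + p = weight X"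
proof -
  obtain \<mu> where \<mu>: "is_partition \<mu>" "X = beads \<mu>" "shape X = \<mu>" using assms(1) by (rule mayaE)
  have x: "x \<in> beads \<mu>" "x - int p \<notin> beads \<mu>" using assms(3) \<mu>(2) by (auto simp: hooks_def)
  obtain \<nu> where \<nu>: "removes_rim_hook p \<mu> \<nu>" "beads \<nu> = bead_move p x (beads \<mu>)"
    by (rule bead_move_removes_rim_hook[OF \<mu>(1) assms(2) x])
  then have "is_partition \<nu>" by (simp add: removes_rim_hook_def)
  then show "bead_move p x X \<in> maya" "weight (bead_move p x X) + p = weight X"
    using \<mu> removes_rim_hook_size[OF \<nu>(1)] by (auto simp: maya_def weight_def simp flip: \<nu>(2))
qed

text \<open>The bead of an empty row cannot move: the place \<open>p\<close> below it belongs to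
  another empty row.\<close>

lemma finite_hooks:
  assumes "X \<in> maya"
  shows "finite (hooks p X)"
proof -
  obtain \<mu> where \<mu>: "is_partition \<mu>" "X = beads \<mu>" using assms by (rule mayaE)
  have "hooks p X \<subseteq> bead \<mu> ` {..<length \<mu>}"
  proof
    fix x assume x: "x \<in> hooks p X"
    then obtain i where i: "x = bead \<mu> i" by (auto simp: hooks_def \<mu> beads_def)
    have "i < length \<mu>"
    proof (rule ccontr)
      assume "\<not> i < length \<mu>"
      then have "bead \<mu> (i + p) = x - int p" by (simp add: i bead_def row_def)
      then have "x - int p \<in> X" unfolding \<mu> beads_def by (metis rangeI)
      then show False using x by (simp add: hooks_def)
    qed
    then show "x \<in> bead \<mu> ` {..<length \<mu>}" using i by blast
  qed
  then show ?thesis by (rule finite_subset) simp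
qed

lemma bead_move_inject:
  assumes "x \<in> hooks p X" "y \<in> hooks p X" "bead_move p x X = bead_move p y X"
  shows "x = y"
proof (rule ccontr)
  assume "x \<noteq> y"
  then have "x \<in> bead_move p y X" using assms(1) by (simp add: hooks_def bead_move_def)
  then have "x \<in> bead_move p x X" using assms(3) by simp
  then show False using assms(1) by (auto simp: hooks_def bead_move_def)
qed

lemma sum_list_partition_eq_0: "is_partition \<mu> \<Longrightarrow> sum_list \<mu> = 0 \<longleftrightarrow> \<mu> = []"
  by (cases \<mu>) (auto simp: is_partition_def)

lemma syt_count_rec:
  assumes "X \<in> maya" "weight X > 0"
  shows "syt_count X = (\<Sum>x\<in>hooks 1 X. syt_count (bead_move 1 x X))"
proof -
  obtain \<mu> where \<mu>: "is_partition \<mu>" "X = beads \<mu>" "shape X = \<mu>" using assms(1) by (rule mayaE)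
  have cov: "young_covers \<kappa> \<mu> \<longleftrightarrow> is_partition \<kappa> \<and> (\<exists>x\<in>hooks 1 X. beads \<kappa> = bead_move 1 x X)" for \<kappa>
    using removes_rim_hook_iff_bead_move[of 1 \<mu> \<kappa>] \<mu> by (simp add: young_covers_iff_removes_rim_hook)
  have mv: "is_partition (shape (bead_move 1 x X))" "beads (shape (bead_move 1 x X)) = bead_move 1 x X"
    if "x \<in> hooks 1 X" for x
    using bead_move_maya(1)[OF assms(1) _ that] by (auto elim: mayaE)
  have "bij_betw (\<lambda>x. shape (bead_move 1 x X)) (hooks 1 X) {\<kappa>. young_covers \<kappa> \<mu>}"
    unfolding bij_betw_def
  proof
    show "inj_on (\<lambda>x. shape (bead_move 1 x X)) (hooks 1 X)"
    proof (rule inj_onI)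
      fix x y assume xy: "x \<in> hooks 1 X" "y \<in> hooks 1 X"
        and "shape (bead_move 1 x X) = shape (bead_move 1 y X)"
      then have "bead_move 1 x X = bead_move 1 y X" using mv(2) by metis
      with xy show "x = y" by (rule bead_move_inject)
    qed
    show "(\<lambda>x. shape (bead_move 1 x X)) ` hooks 1 X = {\<kappa>. young_covers \<kappa> \<mu>}"
    proof (intro equalityI subsetI)
      fix \<kappa> assume "\<kappa> \<in> (\<lambda>x. shape (bead_move 1 x X)) ` hooks 1 X"
      then obtain x where "x \<in> hooks 1 X" "\<kappa> = shape (bead_move 1 x X)" by blast
      with mv[of x] show "\<kappa> \<in> {\<kappa>. young_covers \<kappa> \<mu>}" unfolding cov by blast
    next
      fix \<kappa> assume "\<kappa> \<in> {\<kappa>. young_covers \<kappa> \<mu>}"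
      then obtain x where x: "x \<in> hooks 1 X" "beads \<kappa> = bead_move 1 x X" "is_partition \<kappa>"
        unfolding cov by blast
      then have "\<kappa> = shape (bead_move 1 x X)" using shape_beads[of \<kappa>] by simp
      then show "\<kappa> \<in> (\<lambda>x. shape (bead_move 1 x X)) ` hooks 1 X" using x(1) by blast
    qed
  qed
  then have "(\<Sum>x\<in>hooks 1 X. syt_count (bead_move 1 x X)) = (\<Sum>\<kappa> | young_covers \<kappa> \<mu>. num_syt \<kappa>)"
    unfolding syt_count_def by (rule sum.reindex_bij_betw)
  also have "\<dots> = num_syt \<mu>"
  proof (rule num_syt_rec[OF \<mu>(1), symmetric])
    show "\<mu> \<noteq> []" using assms(2) \<mu>(3) by (auto simp: weight_def)
  qed
  finally show ?thesis by (simp add: syt_count_def \<mu>)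
qed

text \<open>The terms for \<open>(x, y)\<close> and \<open>(y, x)\<close> are equal and cancel
  modulo 2.\<close>

lemma even_sum_symmetric:
  fixes g :: "'a \<Rightarrow> 'a \<Rightarrow> nat"
  assumes "finite A" and sym: "\<And>x y. x \<in> A \<Longrightarrow> y \<in> A \<Longrightarrow> g x y = g y x"
  shows "even (\<Sum>x\<in>A. \<Sum>y\<in>A - {x}. g x y)"
  using assms
proof (induction A rule: finite_induct)
  case (insert a A)
  have "(\<Sum>x\<in>A. \<Sum>y\<in>insert a A - {x}. g x y) = (\<Sum>x\<in>A. g x a + (\<Sum>y\<in>A - {x}. g x y))"
  proof (rule sum.cong)
    fix x assume "x \<in> A"
    then have "insert a A - {x} = insert a (A - {x})" using insert.hyps by auto
    then show "(\<Sum>y\<in>insert a A - {x}. g x y) = g x a + (\<Sum>y\<in>A - {x}. g x y)"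
      using insert.hyps by simp
  qed simp
  also have "\<dots> = (\<Sum>x\<in>A. g x a) + (\<Sum>x\<in>A. \<Sum>y\<in>A - {x}. g x y)"
    by (simp add: sum.distrib)
  finally have "(\<Sum>x\<in>insert a A. \<Sum>y\<in>insert a A - {x}. g x y) =
      (\<Sum>y\<in>A. g a y) + (\<Sum>x\<in>A. g x a) + (\<Sum>x\<in>A. \<Sum>y\<in>A - {x}. g x y)"
    using insert.hyps by simp
  moreover have "(\<Sum>y\<in>A. g a y) = (\<Sum>x\<in>A. g x a)"
    using insert.prems by (intro sum.cong) auto
  ultimately show ?case using insert by simp
qed simp

text \<open>Moving two different beads down by \<open>p\<close> can be done in either order, so modulo 2 only those
  pairs of moves survive that amount to moving one bead down by \<open>2 * p\<close>. This is the congruence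
  \<open>p\<^sub>m\<^sup>2 \<equiv> p\<^sub>2\<^sub>m\<close> for power sums, in its Murnaghan-Nakayama form.\<close>

lemma two_moves_mod_2:
  assumes p: "p > 0" and fin: "finite (hooks p X)" "finite (hooks (2 * p) X)"
  shows "even ((\<Sum>x\<in>hooks p X. \<Sum>y\<in>hooks p (bead_move p x X). G (bead_move p y (bead_move p x X)))
    + (\<Sum>z\<in>hooks (2 * p) X. G (bead_move (2 * p) z X) :: nat))"
proof -
  let ?m = "bead_move p"
  let ?u = "\<lambda>x. if x - 2 * int p \<notin> X then G (bead_move (2 * p) x X) else 0"
  let ?w = "\<lambda>x. if x + int p \<in> X then G (bead_move (2 * p) (x + int p) X) else 0"
  have inner: "(\<Sum>y\<in>hooks p (?m x X). G (?m y (?m x X))) =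
      (\<Sum>y\<in>hooks p X - {x}. G (?m y (?m x X))) + (?u x + ?w x)" if x: "x \<in> hooks p X" for x
  proof -
    \<comment> \<open>After \<open>x\<close> has moved, the other movable beads stay movable and at
      most two new ones arise: the moved bead itself, and a bead at \<open>x + int p\<close>, whose
      target was vacated. Either way the two moves amount to one move by
      \<open>2 * p\<close>.\<close>
    let ?A = "if x - 2 * int p \<notin> X then {x - int p} else {}"
    let ?B = "if x + int p \<in> X then {x + int p} else {}"
    have eq: "hooks p (?m x X) = (hooks p X - {x}) \<union> (?A \<union> ?B)"
      using x p unfolding hooks_def bead_move_def by (auto simp: algebra_simps)
    have disj: "(hooks p X - {x}) \<inter> (?A \<union> ?B) = {}" "?A \<inter> ?B = {}"
      using x p unfolding hooks_def by auto
    have A: "?m (x - int p) (?m x X) = bead_move (2 * p) x X"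
      using x p unfolding hooks_def bead_move_def by auto
    have B: "?m (x + int p) (?m x X) = bead_move (2 * p) (x + int p) X" if "x + int p \<in> X"
      using x p that unfolding hooks_def bead_move_def by auto
    have "(\<Sum>y\<in>hooks p (?m x X). G (?m y (?m x X))) =
       (\<Sum>y\<in>hooks p X - {x}. G (?m y (?m x X))) + (\<Sum>y\<in>?A \<union> ?B. G (?m y (?m x X)))"
      unfolding eq using fin disj(1) by (intro sum.union_disjoint) auto
    also have "(\<Sum>y\<in>?A \<union> ?B. G (?m y (?m x X))) =
        (\<Sum>y\<in>?A. G (?m y (?m x X))) + (\<Sum>y\<in>?B. G (?m y (?m x X)))"
      using disj(2) by (intro sum.union_disjoint) auto
    also have "\<dots> = ?u x + ?w x" using A B by simp
    finally show ?thesis .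
  qed
  have "(\<Sum>x\<in>hooks p X. ?u x) = (\<Sum>x\<in>{x \<in> hooks p X. x - 2 * int p \<notin> X}. G (bead_move (2 * p) x X))"
    using fin by (simp add: sum.inter_filter)
  moreover have "(\<Sum>x\<in>hooks p X. ?w x) =
      (\<Sum>x\<in>{x \<in> hooks p X. x + int p \<in> X}. G (bead_move (2 * p) (x + int p) X))"
    using fin by (simp add: sum.inter_filter)
  moreover have "\<dots> = (\<Sum>z\<in>(\<lambda>x. x + int p) ` {x \<in> hooks p X. x + int p \<in> X}. G (bead_move (2 * p) z X))"
    by (subst sum.reindex) auto
  \<comment> \<open>Each \<open>2 * p\<close>-hook arises in exactly one of the two ways, according
    to whether the place halfway is free or occupied.\<close>
  moreover have "hooks (2 * p) X = {x \<in> hooks p X. x - 2 * int p \<notin> X} \<union>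
      (\<lambda>x. x + int p) ` {x \<in> hooks p X. x + int p \<in> X}" (is "_ = ?P \<union> ?Q")
  proof (intro equalityI subsetI)
    fix z assume z: "z \<in> hooks (2 * p) X"
    show "z \<in> ?P \<union> ?Q"
    proof (cases "z - int p \<in> X")
      case True
      then have "z - int p \<in> {x \<in> hooks p X. x + int p \<in> X}" using z by (auto simp: hooks_def)
      then have "z - int p + int p \<in> ?Q" by (rule imageI)
      then show ?thesis by simp
    qed (use z in \<open>auto simp: hooks_def\<close>)
  qed (auto simp: hooks_def algebra_simps)
  moreover have "?P \<inter> ?Q = {}" by (auto simp: hooks_def)
  ultimately have "(\<Sum>x\<in>hooks p X. ?u x) + (\<Sum>x\<in>hooks p X. ?w x) =
      (\<Sum>z\<in>hooks (2 * p) X. G (bead_move (2 * p) z X))"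
    using fin by (simp add: sum.union_disjoint)
  moreover have "(\<Sum>x\<in>hooks p X. \<Sum>y\<in>hooks p (?m x X). G (?m y (?m x X))) =
      (\<Sum>x\<in>hooks p X. \<Sum>y\<in>hooks p X - {x}. G (?m y (?m x X))) +
      ((\<Sum>x\<in>hooks p X. ?u x) + (\<Sum>x\<in>hooks p X. ?w x))"
    using inner by (simp add: sum.distrib)
  moreover have "even (\<Sum>x\<in>hooks p X. \<Sum>y\<in>hooks p X - {x}. G (?m y (?m x X)))"
  proof (rule even_sum_symmetric[OF fin(1)])
    fix x y assume "x \<in> hooks p X" "y \<in> hooks p X"
    then have "?m y (?m x X) = ?m x (?m y X)" unfolding hooks_def bead_move_def by auto
    then show "G (?m y (?m x X)) = G (?m x (?m y X))" by simp
  qed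
  ultimately show ?thesis by simp
qed

text \<open>Doubling: if \<open>2 ^ Suc k \<le> weight X\<close>, removing one
  \<open>2 ^ k\<close>-hook leaves weight at least \<open>2 ^ k\<close>, so the induction hypothesis
  applies again to each remainder, and \<open>two_moves_mod_2\<close> merges the two rounds.\<close>

lemma odd_syt_count_hooks:
  assumes "X \<in> maya" "2 ^ k \<le> weight X"
  shows "odd (syt_count X) \<longleftrightarrow> odd (\<Sum>x\<in>hooks (2 ^ k) X. syt_count (bead_move (2 ^ k) x X))"
  using assms
proof (induction k arbitrary: X)
  case 0
  then show ?case using syt_count_rec[of X] by simp
next
  case (Suc k)
  let ?p = "2 ^ k :: nat"
  have "odd (syt_count X) \<longleftrightarrow> odd (\<Sum>x\<in>hooks ?p X. syt_count (bead_move ?p x X))"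
    using Suc by simp
  also have "\<dots> \<longleftrightarrow> odd (\<Sum>x\<in>hooks ?p X. \<Sum>y\<in>hooks ?p (bead_move ?p x X).
      syt_count (bead_move ?p y (bead_move ?p x X)))"
  proof -
    have "odd (syt_count (bead_move ?p x X)) \<longleftrightarrow>
        odd (\<Sum>y\<in>hooks ?p (bead_move ?p x X). syt_count (bead_move ?p y (bead_move ?p x X)))"
      if x: "x \<in> hooks ?p X" for x
      using bead_move_maya[OF Suc.prems(1) _ x] Suc.prems(2) by (intro Suc.IH) auto
    then have "{x \<in> hooks ?p X. odd (syt_count (bead_move ?p x X))} = {x \<in> hooks ?p X.
        odd (\<Sum>y\<in>hooks ?p (bead_move ?p x X). syt_count (bead_move ?p y (bead_move ?p x X)))}"
      by blast
    then show ?thesis using finite_hooks[OF Suc.prems(1)] by (simp add: even_sum_iff)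
  qed
  also have "\<dots> \<longleftrightarrow> odd (\<Sum>z\<in>hooks (2 * ?p) X. syt_count (bead_move (2 * ?p) z X))"
    using two_moves_mod_2[of ?p X syt_count] finite_hooks[OF Suc.prems(1)] by simp
  finally show ?case by simp
qed

section \<open>Stripping the leading hook\<close>

text \<open>Distinct movable beads do not obstruct each other, so both hooks could be removed in
  turn, at the cost of weight \<open>2 * p\<close>.\<close>

lemma hooks_unique:
  assumes X: "X \<in> maya" and p: "p > 0" and w: "weight X < 2 * p"
    and xy: "x \<in> hooks p X" "y \<in> hooks p X"
  shows "x = y"
proof (rule ccontr)
  assume "x \<noteq> y"
  then have "y \<in> hooks p (bead_move p x X)"
    using xy by (auto simp: hooks_def bead_move_def)
  then show False
    using bead_move_maya[OF X p xy(1)] bead_move_maya(2)[of "bead_move p x X" p y] p w by simp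
qed

lemma no_double_hook:
  assumes X: "X \<in> maya" and p: "p > 0" and w: "weight X < 2 * p" and x: "x \<in> X"
  shows "x - 2 * int p \<in> X"
proof (rule ccontr)
  assume "x - 2 * int p \<notin> X"
  then have "x \<in> hooks (2 * p) X" using x by (simp add: hooks_def)
  then show False using bead_move_maya(2)[OF X, of "2 * p" x] p w by simp
qed

section \<open>Adding a box before and after removing the unique hook\<close>

definition add_box :: "int \<Rightarrow> int set \<Rightarrow> int set" where
  "add_box r X = insert (r + 1) (X - {r})"

lemma add_box_maya:
  assumes "X \<in> maya" "r \<in> X" "r + 1 \<notin> X"
  shows "add_box r X \<in> maya"
proof -
  obtain \<mu> where \<mu>: "is_partition \<mu>" "X = beads \<mu>" using assms(1) by (rule mayaE)
  obtain i where i: "r = bead \<mu> i" using assms(2) \<mu>(2) by (auto simp: beads_def)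
  have inj: "bead \<mu> k = bead \<mu> l \<longleftrightarrow> k = l" for k l
    by (metis bead_less[OF \<mu>(1)] less_irrefl linorder_neqE_nat)
  have ne: "bead \<mu> k \<noteq> r + 1" for k using assms(3) \<mu>(2) by (metis beads_def rangeI)
  obtain \<nu> where \<nu>: "is_partition \<nu>" "bead \<nu> = (bead \<mu>)(i := r + 1)"
  proof (rule ex_partition_bead[where g = "(bead \<mu>)(i := r + 1)" and L = "length \<mu> + Suc i"])
    fix k show "((bead \<mu>)(i := r + 1)) (Suc k) < ((bead \<mu>)(i := r + 1)) k"
      using bead_less[OF \<mu>(1), of k "Suc k"] ne[of k] i by auto
  next
    fix k assume "length \<mu> + Suc i \<le> k"
    then show "((bead \<mu>)(i := r + 1)) k = - int k" by (simp add: bead_def row_def)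
  qed
  have "beads \<nu> = add_box r X"
    unfolding beads_def \<nu> add_box_def \<mu>(2) i by (auto simp: inj)
  then show ?thesis using \<nu>(1) by (auto simp: maya_def)
qed

definition odd_cover :: "int set \<Rightarrow> int set \<Rightarrow> bool" where
  "odd_cover X Y \<longleftrightarrow> X \<in> maya \<and> Y \<in> maya \<and> odd (syt_count X) \<and> odd (syt_count Y) \<and>
     (\<exists>r\<in>X. r + 1 \<notin> X \<and> Y = add_box r X)"

lemma add_box_hook:
  assumes "r \<in> X" "r + 1 \<notin> X"
  shows "r + 1 \<in> hooks 1 (add_box r X)" "bead_move 1 (r + 1) (add_box r X) = X"
  using assms by (auto simp: hooks_def add_box_def bead_move_def)

lemma hook_add_box:
  assumes "s \<in> hooks 1 Y"
  shows "s - 1 \<in> bead_move 1 s Y" "s \<notin> bead_move 1 s Y" "Y = add_box (s - 1) (bead_move 1 s Y)"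
  using assms by (auto simp: hooks_def add_box_def bead_move_def)

lemma add_box_inject:
  assumes "r + 1 \<notin> X" "s + 1 \<notin> X" "add_box r X = add_box s X"
  shows "r = s"
proof -
  have "r + 1 \<in> add_box r X" by (simp add: add_box_def)
  then have "r + 1 \<in> add_box s X" unfolding assms(3) .
  then show ?thesis using assms(1) by (simp add: add_box_def)
qed

lemma weight_add_box:
  assumes "X \<in> maya" "r \<in> X" "r + 1 \<notin> X"
  shows "weight (add_box r X) = Suc (weight X)"
  using bead_move_maya(2)[OF add_box_maya[OF assms] _ add_box_hook(1)[OF assms(2,3)]]
    add_box_hook(2)[OF assms(2,3)] by simp

lemma odd_cover_weight: "odd_cover X Y \<Longrightarrow> weight Y = Suc (weight X)"
  using weight_add_box by (auto simp: odd_cover_def)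

text \<open>Let \<open>x\<close> be the only bead of \<open>X\<close> that can move down by \<open>p\<close>. Adding a box to \<open>X\<close> by moving the
  bead \<open>r\<close> corresponds to adding a box to \<open>bead_move p x X\<close> by moving the bead \<open>box_shift p x r\<close>.\<close>

definition box_shift :: "nat \<Rightarrow> int \<Rightarrow> int \<Rightarrow> int" where
  "box_shift p x r = (if r = x then x - int p else if r = x - int p - 1 then x - 1 else r)"

text \<open>If \<open>x\<close> itself takes the box, it still moves, from \<open>x + 1\<close>, and
  carries the box along. If the box fills the gap \<open>x - int p\<close>, then \<open>x\<close> is
  blocked and the bead at \<open>x - 1\<close> moves into the place just vacated; the outcome is the
  same as raising the bead \<open>x - 1\<close> after stripping \<open>X\<close>. Otherwise box and
  hook are independent.\<close>

lemma strip_add_box: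
  assumes X: "X \<in> maya" and Y: "add_box r X \<in> maya" and p: "p \<ge> 2"
    and wX: "weight X < 2 * p" and wY: "weight (add_box r X) < 2 * p"
    and r: "r \<in> X" "r + 1 \<notin> X" and x: "x \<in> hooks p X" and y: "y \<in> hooks p (add_box r X)"
  defines "r' \<equiv> box_shift p x r"
  shows "r' \<in> bead_move p x X" "r' + 1 \<notin> bead_move p x X"
    "bead_move p y (add_box r X) = add_box r' (bead_move p x X)"
    "y = (if r = x then x + 1 else if r = x - int p - 1 then x - 1 else x)"
proof -
  let ?Y = "add_box r X"
  have p0: "p > 0" using p by simp
  have ux: "z = x" if "z \<in> X" "z - int p \<notin> X" for z
    using hooks_unique[OF X p0 wX _ x, of z] that by (simp add: hooks_def)
  have uy: "z = y" if "z \<in> ?Y" "z - int p \<notin> ?Y" for z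
    using hooks_unique[OF Y p0 wY _ y, of z] that by (simp add: hooks_def)
  have x': "x \<in> X" "x - int p \<notin> X" using x by (auto simp: hooks_def)
  have y': "y = r + 1 \<or> y \<in> X \<and> y \<noteq> r" "y - int p \<noteq> r + 1" "y - int p \<in> X \<Longrightarrow> y - int p = r"
    using y by (auto simp: hooks_def add_box_def)
  have dbl: "z - 2 * int p \<in> X" if "z \<in> X" for z using no_double_hook[OF X p0 wX that] .
  consider (1) "r = x" | (2) "r = x - int p - 1" "r \<noteq> x" | (3) "r \<noteq> x" "r \<noteq> x - int p - 1" by blast
  then have "r' \<in> bead_move p x X \<and> r' + 1 \<notin> bead_move p x X \<and>
    bead_move p y ?Y = add_box r' (bead_move p x X) \<and>
    y = (if r = x then x + 1 else if r = x - int p - 1 then x - 1 else x)"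
  proof cases
    case 1
    have yx: "y = x + 1"
    proof (rule ccontr)
      assume "y \<noteq> x + 1"
      then have "y \<in> X" "y \<noteq> x" using y' 1 by auto
      \<comment> \<open>So \<open>y\<close> sits at \<open>x + int p\<close>, and the place two
        steps below it would be the free place \<open>x - int p\<close>.\<close>
      then have "y - int p = x" using ux y'(3) 1 by blast
      then show False using dbl[OF \<open>y \<in> X\<close>] x' by (simp add: algebra_simps)
    qed
    have "x + 1 - int p \<notin> X" using y'(3) yx 1 p by auto
    then show ?thesis
      using 1 yx x' r p unfolding r'_def box_shift_def bead_move_def add_box_def
      by (auto simp: algebra_simps)
  next
    case 2
    \<comment> \<open>The bead that has filled the gap cannot move on: \<open>x - 2 * int p\<close>
      is occupied, and for \<open>p \<ge> 2\<close> it is not the vacated place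
      \<open>r\<close>.\<close>
    have "y \<noteq> r + 1"
    proof
      assume "y = r + 1"
      then have "x - 2 * int p \<notin> X \<or> x - 2 * int p = r" using y'(3) 2 by (auto simp: algebra_simps)
      then show False using dbl[OF x'(1)] 2 p by auto
    qed
    then have "y \<in> X" "y \<noteq> x" using y' 2 by auto
    then have "y - int p = r" using ux y'(3) by blast
    then have yx: "y = x - 1" using 2 by simp
    then show ?thesis
      using 2 yx x' r p \<open>y \<in> X\<close> unfolding r'_def box_shift_def bead_move_def add_box_def
      by (auto simp: algebra_simps)
  next
    case 3
    have "x \<in> ?Y" "x - int p \<notin> ?Y" using 3 x' by (auto simp: add_box_def)
    then have "x = y" by (rule uy)
    then show ?thesis
      using 3 x' r p unfolding r'_def box_shift_def bead_move_def add_box_def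
      by (auto simp: algebra_simps)
  qed
  then show "r' \<in> bead_move p x X" "r' + 1 \<notin> bead_move p x X"
    "bead_move p y (add_box r X) = add_box r' (bead_move p x X)"
    "y = (if r = x then x + 1 else if r = x - int p - 1 then x - 1 else x)"
    by blast+
qed

text \<open>The cases invert \<open>box_shift\<close>. Uniqueness of the movable bead settles the
  neighbouring places: a bead at \<open>x + 1\<close> in the first case, or one at
  \<open>x - 1\<close> above a gap in the second, would be a second movable bead.\<close>

lemma lift_add_box:
  assumes X: "X \<in> maya" and p: "p \<ge> 2" and wX: "weight X < 2 * p" and x: "x \<in> hooks p X"
    and s: "s \<in> bead_move p x X" "s + 1 \<notin> bead_move p x X"
  obtains r y where "r \<in> X" "r + 1 \<notin> X" "y \<in> hooks p (add_box r X)"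
    "bead_move p y (add_box r X) = add_box s (bead_move p x X)"
proof -
  have p0: "p > 0" using p by simp
  have ux: "z = x" if "z \<in> X" "z - int p \<notin> X" for z
    using hooks_unique[OF X p0 wX _ x, of z] that by (simp add: hooks_def)
  have x': "x \<in> X" "x - int p \<notin> X" using x by (auto simp: hooks_def)
  have s': "s = x - int p \<or> s \<in> X \<and> s \<noteq> x" "s + 1 \<noteq> x - int p" "s + 1 \<in> X \<Longrightarrow> s + 1 = x"
    using s by (auto simp: bead_move_def)
  consider (1) "s = x - int p" | (2) "s = x - 1" "s \<noteq> x - int p" | (3) "s \<noteq> x - int p" "s \<noteq> x - 1"
    by blast
  then show ?thesis
  proof cases
    case 1
    have a: "x + 1 - int p \<notin> X" using s'(3) 1 p by (auto simp: algebra_simps)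
    have b: "x + 1 \<notin> X" using ux[of "x + 1"] a by auto
    show ?thesis
      by (rule that[of x "x + 1"])
        (use 1 a b x' p in \<open>auto simp: hooks_def bead_move_def add_box_def algebra_simps\<close>)
  next
    case 2
    have a: "x - 1 \<in> X" using s' 2 by auto
    have b: "x - 1 - int p \<in> X" using ux[of "x - 1"] a by auto
    show ?thesis
      by (rule that[of "x - int p - 1" "x - 1"])
        (use 2 a b x' p in \<open>auto simp: hooks_def bead_move_def add_box_def algebra_simps\<close>)
  next
    case 3
    then have a: "s \<in> X" "s \<noteq> x" "s + 1 \<notin> X" using s' by auto
    show ?thesis
      by (rule that[of s x])
        (use 3 a x' s' p in \<open>auto simp: hooks_def bead_move_def add_box_def algebra_simps\<close>)
  qed
qed

text \<open>The bounds say that \<open>2 ^ k\<close> is the leading binary digit of the weight. This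
  is a relation because the hook may fail to exist when the shape is not odd.\<close>

definition strips :: "nat \<Rightarrow> int set \<Rightarrow> int set \<Rightarrow> bool" where
  "strips k X X' \<longleftrightarrow> X \<in> maya \<and> 2 ^ k \<le> weight X \<and> weight X < 2 * 2 ^ k \<and>
     (\<exists>x\<in>hooks (2 ^ k) X. X' = bead_move (2 ^ k) x X)"

lemma ex_strips:
  assumes "X \<in> maya" "odd (syt_count X)" "2 ^ k \<le> weight X" "weight X < 2 * 2 ^ k"
  obtains X' where "strips k X X'"
proof -
  have "hooks (2 ^ k) X \<noteq> {}" using odd_syt_count_hooks[OF assms(1,3)] assms(2) by auto
  then show ?thesis using that assms unfolding strips_def by blast
qed

lemma strips_weight: "strips k X X' \<Longrightarrow> weight X' + 2 ^ k = weight X"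
  using bead_move_maya(2) by (auto simp: strips_def)

lemma strips_maya: "strips k X X' \<Longrightarrow> X' \<in> maya"
  using bead_move_maya(1) by (auto simp: strips_def)

lemma strips_odd:
  assumes "strips k X X'"
  shows "odd (syt_count X) \<longleftrightarrow> odd (syt_count X')"
proof -
  obtain x where x: "x \<in> hooks (2 ^ k) X" "X' = bead_move (2 ^ k) x X"
    and X: "X \<in> maya" "2 ^ k \<le> weight X" "weight X < 2 * 2 ^ k"
    using assms by (auto simp: strips_def)
  have "hooks (2 ^ k) X = {x}" using hooks_unique[OF X(1) _ X(3)] x(1) by auto
  then show ?thesis using odd_syt_count_hooks[OF X(1,2)] x(2) by simp
qed

lemma strips_add_boxE:
  assumes c: "odd_cover X Y" and sX: "strips k X X'" and sY: "strips k Y Y'"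
  obtains r x y where "r \<in> X" "r + 1 \<notin> X" "Y = add_box r X"
    "x \<in> hooks (2 ^ k) X" "X' = bead_move (2 ^ k) x X" "y \<in> hooks (2 ^ k) Y" "Y' = bead_move (2 ^ k) y Y"
    "box_shift (2 ^ k) x r \<in> X'" "box_shift (2 ^ k) x r + 1 \<notin> X'"
    "Y' = add_box (box_shift (2 ^ k) x r) X'"
    "y = (if r = x then x + 1 else if r = x - 2 ^ k - 1 then x - 1 else x)"
proof -
  obtain r where r: "X \<in> maya" "Y \<in> maya" "r \<in> X" "r + 1 \<notin> X" "Y = add_box r X"
    using c by (auto simp: odd_cover_def)
  obtain x y where x: "x \<in> hooks (2 ^ k) X" "X' = bead_move (2 ^ k) x X"
    and y: "y \<in> hooks (2 ^ k) Y" "Y' = bead_move (2 ^ k) y Y"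
    using sX sY by (auto simp: strips_def)
  have w: "2 ^ k \<le> weight X" "weight X < 2 * 2 ^ k" "weight Y < 2 * 2 ^ k"
    using sX sY by (auto simp: strips_def)
  \<comment> \<open>Two consecutive weights have the same leading digit \<open>2 ^ k\<close>, which
    excludes hook length 1.\<close>
  then have p: "(2::nat) \<le> 2 ^ k" using odd_cover_weight[OF c] by linarith
  note * = strip_add_box[OF r(1) _ p w(2) _ r(3,4) x(1), folded r(5), OF r(2) w(3) y(1)]
  show ?thesis
    by (rule that[OF r(3,4,5) x y]) (use * x(2) y(2) in \<open>simp_all add: r(5)\<close>)
qed

lemma strips_odd_cover:
  assumes "odd_cover X Y" "strips k X X'" "strips k Y Y'"
  shows "odd_cover X' Y'"
proof -
  from strips_add_boxE[OF assms] obtain r where "r \<in> X'" "r + 1 \<notin> X'" "Y' = add_box r X'"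
    by metis
  then show ?thesis
    using assms strips_maya strips_odd unfolding odd_cover_def by blast
qed

text \<open>The weight bound keeps the leading digit when a box is added, so the set found by
  \<open>lift_add_box\<close> is again stripped by a \<open>2 ^ k\<close>-hook.\<close>

lemma lift_odd_cover:
  assumes X: "odd (syt_count X)" and s: "strips k X X'" and c: "odd_cover X' Y'"
    and w: "Suc (weight X) < 2 * 2 ^ k"
  obtains Y where "odd_cover X Y" "strips k Y Y'"
proof -
  obtain x where x: "x \<in> hooks (2 ^ k) X" "X' = bead_move (2 ^ k) x X"
    and Xm: "X \<in> maya" "2 ^ k \<le> weight X" "weight X < 2 * 2 ^ k"
    using s by (auto simp: strips_def)
  obtain r' where r': "r' \<in> X'" "r' + 1 \<notin> X'" "Y' = add_box r' X'" "odd (syt_count Y')"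
    using c by (auto simp: odd_cover_def)
  have p: "(2::nat) \<le> 2 ^ k" using w Xm by linarith
  obtain r y where r: "r \<in> X" "r + 1 \<notin> X" "y \<in> hooks (2 ^ k) (add_box r X)"
    "bead_move (2 ^ k) y (add_box r X) = Y'"
    using lift_add_box[OF Xm(1) p Xm(3) x(1), of r'] r' x(2) by blast
  have "add_box r X \<in> maya" by (rule add_box_maya[OF Xm(1) r(1,2)])
  then have sY: "strips k (add_box r X) Y'"
    using r weight_add_box[OF Xm(1) r(1,2)] w Xm by (auto simp: strips_def)
  then have "odd (syt_count (add_box r X))" using strips_odd r'(4) by blast
  then have "odd_cover X (add_box r X)"
    using Xm X r \<open>add_box r X \<in> maya\<close> by (auto simp: odd_cover_def)
  then show ?thesis using sY by (rule that)
qed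

text \<open>\<open>box_shift\<close> is injective on addable boxes: of its two exceptional values,
  \<open>x - 2 ^ k\<close> is no bead of \<open>X\<close>, and \<open>x - 1\<close> has the occupied
  place \<open>x\<close> above it. They differ since \<open>k \<noteq> 0\<close>.\<close>

lemma lift_unique_up:
  assumes "odd_cover X Y\<^sub>1" "odd_cover X Y\<^sub>2" "strips k X X'" "strips k Y\<^sub>1 Y'" "strips k Y\<^sub>2 Y'"
  shows "Y\<^sub>1 = Y\<^sub>2"
proof -
  let ?f = "box_shift (2 ^ k)"
  have Xm: "X \<in> maya" "weight X < 2 * 2 ^ k" using assms(3) by (auto simp: strips_def)
  obtain r1 x1 where 1: "r1 \<in> X" "r1 + 1 \<notin> X" "Y\<^sub>1 = add_box r1 X" "x1 \<in> hooks (2 ^ k) X"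
    "?f x1 r1 + 1 \<notin> X'" "Y' = add_box (?f x1 r1) X'"
    by (rule strips_add_boxE[OF assms(1,3,4)])
  obtain r2 x2 where 2: "r2 \<in> X" "r2 + 1 \<notin> X" "Y\<^sub>2 = add_box r2 X" "x2 \<in> hooks (2 ^ k) X"
    "?f x2 r2 + 1 \<notin> X'" "Y' = add_box (?f x2 r2) X'"
    by (rule strips_add_boxE[OF assms(2,3,5)])
  have x: "x2 = x1" using hooks_unique[OF Xm(1) _ Xm(2) 2(4) 1(4)] by simp
  have eq: "?f x1 r1 = ?f x1 r2"
    using add_box_inject[OF 1(5) 2(5)] 1(6) 2(6) x by simp
  have "x1 \<in> X" "x1 - 2 ^ k \<notin> X" using 1(4) by (auto simp: hooks_def)
  then have "r1 \<noteq> x1 - 2 ^ k" "r2 \<noteq> x1 - 2 ^ k" "r1 \<noteq> x1 - 1" "r2 \<noteq> x1 - 1"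
    using 1 2 by auto
  moreover have "k \<noteq> 0"
    using odd_cover_weight[OF assms(1)] assms(3,4) by (cases k) (auto simp: strips_def)
  ultimately have "r1 = r2" using eq by (auto simp: box_shift_def split: if_splits)
  then show ?thesis using 1 2 by simp
qed

text \<open>The movable bead \<open>y\<close> of \<open>Y\<close> is unique, and the shifted box
  reveals the case: it lies at \<open>y - 1 - 2 ^ k\<close>, at \<open>y\<close>, or elsewhere. So
  \<open>y\<close> and the shifted box determine \<open>r\<close>, and with it the parent.\<close>

lemma lift_unique_down:
  assumes "odd_cover X\<^sub>1 Y" "odd_cover X\<^sub>2 Y" "strips k X\<^sub>1 X'" "strips k X\<^sub>2 X'" "strips k Y Y'"
  shows "X\<^sub>1 = X\<^sub>2"
proof -
  let ?f = "box_shift (2 ^ k)"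
  have Ym: "Y \<in> maya" "weight Y < 2 * 2 ^ k" using assms(5) by (auto simp: strips_def)
  obtain r1 x1 y1 where 1: "r1 \<in> X\<^sub>1" "r1 + 1 \<notin> X\<^sub>1" "Y = add_box r1 X\<^sub>1" "y1 \<in> hooks (2 ^ k) Y"
    "?f x1 r1 + 1 \<notin> X'" "Y' = add_box (?f x1 r1) X'"
    "y1 = (if r1 = x1 then x1 + 1 else if r1 = x1 - 2 ^ k - 1 then x1 - 1 else x1)"
    by (rule strips_add_boxE[OF assms(1,3,5)])
  obtain r2 x2 y2 where 2: "r2 \<in> X\<^sub>2" "r2 + 1 \<notin> X\<^sub>2" "Y = add_box r2 X\<^sub>2" "y2 \<in> hooks (2 ^ k) Y"
    "?f x2 r2 + 1 \<notin> X'" "Y' = add_box (?f x2 r2) X'"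
    "y2 = (if r2 = x2 then x2 + 1 else if r2 = x2 - 2 ^ k - 1 then x2 - 1 else x2)"
    by (rule strips_add_boxE[OF assms(2,4,5)])
  have y: "y2 = y1" using hooks_unique[OF Ym(1) _ Ym(2) 2(4) 1(4)] by simp
  have eq: "?f x1 r1 = ?f x2 r2"
    using add_box_inject[OF 1(5) 2(5)] 1(6) 2(6) by simp
  have "(2::int) ^ k > 0" by simp
  then have "r1 = r2"
    using eq 1(7) 2(7) y by (auto simp: box_shift_def split: if_splits)
  then show ?thesis
    using add_box_hook(2)[OF 1(1,2)] add_box_hook(2)[OF 2(1,2)] 1(3) 2(3) by simp
qed

lemma maya_weight_0:
  assumes "X \<in> maya" "weight X = 0"
  shows "X = {..0}"
proof -
  obtain \<mu> where \<mu>: "is_partition \<mu>" "X = beads \<mu>" "shape X = \<mu>" using assms(1) by (rule mayaE)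
  then have "\<mu> = []" using assms(2) sum_list_partition_eq_0 by (simp add: weight_def)
  then have "X = range (\<lambda>i. - int i)" by (simp add: \<mu> beads_def bead_def row_def)
  also have "\<dots> = {..0}"
  proof (intro equalityI subsetI)
    fix z :: int assume "z \<in> {..0}"
    then have "z = - int (nat (- z))" by simp
    then show "z \<in> range (\<lambda>i. - int i)" by blast
  qed auto
  finally show ?thesis .
qed

lemma obtain_power_of_2:
  fixes n :: nat
  assumes "n > 0"
  obtains k where "2 ^ k \<le> n" "n < 2 * 2 ^ k"
  using ex_power_ivl1[of 2 n] assms by force

text \<open>If \<open>weight Y\<close> is a power of 2, then \<open>Y\<close> is a hook and has at most two removable boxes;
  the number of odd partitions it covers is odd, hence 1. Otherwise strip the leading hook.\<close>

lemma odd_parent_unique: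
  assumes "odd_cover X\<^sub>1 Y" "odd_cover X\<^sub>2 Y"
  shows "X\<^sub>1 = X\<^sub>2"
  using assms
proof (induction "weight Y" arbitrary: X\<^sub>1 X\<^sub>2 Y rule: less_induct)
  case less
  have Y: "Y \<in> maya" "odd (syt_count Y)" using less.prems by (auto simp: odd_cover_def)
  have w: "weight Y = Suc (weight X\<^sub>1)" "weight Y = Suc (weight X\<^sub>2)"
    using less.prems by (blast dest: odd_cover_weight)+
  obtain k where k: "2 ^ k \<le> weight Y" "weight Y < 2 * 2 ^ k"
    using obtain_power_of_2[of "weight Y"] w by auto
  obtain Y' where sY: "strips k Y Y'" using ex_strips[OF Y k] .
  show ?case
  proof (cases "weight Y = 2 ^ k")
    case False
    then have "2 ^ k \<le> weight X\<^sub>1" "weight X\<^sub>1 < 2 * 2 ^ k" "2 ^ k \<le> weight X\<^sub>2" "weight X\<^sub>2 < 2 * 2 ^ k"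
      using k w by auto
    then obtain X1' X2' where s: "strips k X\<^sub>1 X1'" "strips k X\<^sub>2 X2'"
      using ex_strips less.prems unfolding odd_cover_def by metis
    have "weight Y' < weight Y"
      using strips_weight[OF sY] zero_less_power[of "2::nat" k] by linarith
    then have "X1' = X2'"
      using less.hyps strips_odd_cover less.prems s sY by blast
    then show ?thesis using lift_unique_down less.prems s sY by blast
  next
    case True
    then have "weight Y' = 0" using strips_weight[OF sY] by simp
    then have Y': "Y' = {..0}" using maya_weight_0 strips_maya[OF sY] by blast
    obtain y where y: "y \<in> hooks (2 ^ k) Y" "Y' = bead_move (2 ^ k) y Y"
      using sY by (auto simp: strips_def)
    define c where "c = y - 2 ^ k"
    \<comment> \<open>\<open>Y\<close> is the empty partition's \<open>{..0}\<close> with the bead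
      \<open>c\<close> lifted to \<open>y\<close>. Only \<open>y\<close> and the bead just above the
      hole \<open>c\<close> can have a gap directly below.\<close>
    have mem: "z \<in> Y \<longleftrightarrow> z = y \<or> z \<le> 0 \<and> z \<noteq> c" for z
    proof -
      have "z \<in> Y' \<longleftrightarrow> z = c \<or> z \<in> Y \<and> z \<noteq> y" unfolding y(2) by (auto simp: bead_move_def c_def)
      moreover have "c \<notin> Y" "y \<in> Y" using y(1) by (auto simp: hooks_def c_def)
      moreover have "z \<in> Y' \<longleftrightarrow> z \<le> 0" by (simp add: Y')
      ultimately show ?thesis by blast
    qed
    have sub: "hooks 1 Y \<subseteq> {y, c + 1}"
    proof
      fix z assume "z \<in> hooks 1 Y"
      then show "z \<in> {y, c + 1}" using mem[of z] mem[of "z - 1"] by (auto simp: hooks_def)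
    qed
    obtain r1 r2 where r1: "r1 \<in> X\<^sub>1" "r1 + 1 \<notin> X\<^sub>1" "Y = add_box r1 X\<^sub>1"
      and r2: "r2 \<in> X\<^sub>2" "r2 + 1 \<notin> X\<^sub>2" "Y = add_box r2 X\<^sub>2"
      using less.prems by (auto simp: odd_cover_def)
    note h1 = add_box_hook[OF r1(1,2), folded r1(3)]
    note h2 = add_box_hook[OF r2(1,2), folded r2(3)]
    show ?thesis
    proof (rule ccontr)
      assume "X\<^sub>1 \<noteq> X\<^sub>2"
      then have ne: "r1 + 1 \<noteq> r2 + 1" using h1(2) h2(2) by metis
      have "r1 + 1 \<in> {y, c + 1}" "r2 + 1 \<in> {y, c + 1}" using subsetD[OF sub h1(1)] subsetD[OF sub h2(1)] .
      then have "{y, c + 1} = {r1 + 1, r2 + 1}" using ne by auto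
      then have "hooks 1 Y = {r1 + 1, r2 + 1}"
        using sub h1(1) h2(1) by (intro subset_antisym) simp_all
      then have "syt_count Y = syt_count X\<^sub>1 + syt_count X\<^sub>2"
        using syt_count_rec[OF Y(1)] w ne h1(2) h2(2) by simp
      then show False using Y(2) less.prems by (simp add: odd_cover_def)
    qed
  qed
qed

section \<open>Reduction to the core\<close>

definition hook_step :: "nat \<Rightarrow> int set \<Rightarrow> int set \<Rightarrow> bool" where
  "hook_step q X Z \<longleftrightarrow> X \<in> maya \<and> (\<exists>x\<in>hooks q X. Z = bead_move q x X)"

text \<open>A final weight below \<open>q\<close> is more than irreducibility, as a
  \<open>q\<close>-core can be large. Odd shapes reach such a weight when \<open>q\<close> is a
  power of 2, see \<open>ex_reduces\<close>.\<close>

definition reduces :: "nat \<Rightarrow> int set \<Rightarrow> int set \<Rightarrow> bool" where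
  "reduces q X Z \<longleftrightarrow> (hook_step q)\<^sup>*\<^sup>* X Z \<and> weight Z < q"

lemma hook_step_weight:
  assumes "q > 0" "hook_step q X Z"
  shows "weight Z + q = weight X"
proof -
  obtain x where "X \<in> maya" "x \<in> hooks q X" "Z = bead_move q x X"
    using assms(2) by (auto simp: hook_step_def)
  then show ?thesis using bead_move_maya(2)[OF _ assms(1)] by simp
qed

text \<open>Different movable beads have different targets, so neither move blocks the other and the
  moves commute.\<close>

lemma hook_step_diamond:
  assumes q: "q > 0" and "hook_step q X A" "hook_step q X B" "A \<noteq> B"
  obtains C where "hook_step q A C" "hook_step q B C"
proof -
  obtain a b where X: "X \<in> maya" and a: "a \<in> hooks q X" "A = bead_move q a X"
    and b: "b \<in> hooks q X" "B = bead_move q b X"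
    using assms by (auto simp: hook_step_def)
  have "a \<noteq> b" using assms a b by auto
  then have "b \<in> hooks q A" "a \<in> hooks q B" "bead_move q b A = bead_move q a B"
    using a b by (auto simp: hooks_def bead_move_def)
  moreover have "A \<in> maya" "B \<in> maya" using bead_move_maya(1)[OF X q] a b by auto
  ultimately show ?thesis using that unfolding hook_step_def by blast
qed

text \<open>The diamond is pushed along the path to \<open>Z\<close>: whenever \<open>A\<close>
  leaves the path, a common successor takes over its role one step further on.\<close>

lemma hook_steps_to_terminal:
  assumes q: "q > 0" and "(hook_step q)\<^sup>*\<^sup>* X Z" "\<nexists>W. hook_step q Z W" "(hook_step q)\<^sup>*\<^sup>* X A"
  shows "(hook_step q)\<^sup>*\<^sup>* A Z"
proof -
  have one: "(hook_step q)\<^sup>*\<^sup>* A Z" if "(hook_step q)\<^sup>*\<^sup>* X Z" "hook_step q X A" for X A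
    using that
  proof (induction arbitrary: A rule: converse_rtranclp_induct)
    case base
    then show ?case using assms(3) by blast
  next
    case (step X B)
    show ?case
    proof (cases "A = B")
      case False
      then obtain C where "hook_step q A C" "hook_step q B C"
        using hook_step_diamond[OF q step.prems step.hyps(1)] by blast
      then show ?thesis using step.IH by (meson converse_rtranclp_into_rtranclp)
    qed (use step in simp)
  qed
  show ?thesis using assms(4,2) by (induction rule: rtranclp_induct) (auto intro: one)
qed

lemma light_terminal:
  assumes "q > 0" "weight Z < q"
  shows "\<nexists>W. hook_step q Z W"
proof
  assume "\<exists>W. hook_step q Z W"
  then obtain W where "hook_step q Z W" ..
  from hook_step_weight[OF assms(1) this] show False using assms(2) by simp
qed

lemma reduces_small:
  assumes "q > 0" "weight X < q" "reduces q X A"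
  shows "A = X"
proof -
  have "(hook_step q)\<^sup>*\<^sup>* X A" using assms(3) by (simp add: reduces_def)
  then show ?thesis
    by (cases rule: converse_rtranclpE) (use light_terminal[OF assms(1,2)] in blast)+
qed

lemma reduces_steps:
  assumes q: "q > 0" and s: "(hook_step q)\<^sup>*\<^sup>* X X'"
  shows "reduces q X A \<longleftrightarrow> reduces q X' A"
proof
  assume "reduces q X A"
  then show "reduces q X' A"
    using hook_steps_to_terminal[OF q _ light_terminal[OF q] s] by (simp add: reduces_def)
next
  assume "reduces q X' A"
  then show "reduces q X A" using s unfolding reduces_def by (blast intro: rtranclp_trans)
qed

lemma reduces_weight:
  assumes "q > 0" "reduces q X A"
  shows "weight A = weight X mod q"
proof -
  have "(hook_step q)\<^sup>*\<^sup>* X A" "weight A < q" using assms by (auto simp: reduces_def)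
  from this(1) have "weight X mod q = weight A mod q"
  proof (induction rule: rtranclp_induct)
    case (step Y Z)
    then show ?case using hook_step_weight[OF assms(1)] by (metis mod_add_self2)
  qed simp
  with \<open>weight A < q\<close> show ?thesis by simp
qed

text \<open>If the place \<open>q\<close> below is free, \<open>x\<close> steps there and travels
  on. If it is occupied, the bead there makes the rest of the journey and \<open>x\<close> takes its
  place; the resulting sets coincide.\<close>

lemma multiple_hook_steps:
  assumes "q > 0" "X \<in> maya" "x \<in> hooks (q * Suc j) X"
  shows "(hook_step q)\<^sup>*\<^sup>* X (bead_move (q * Suc j) x X)"
  using assms
proof (induction j arbitrary: x X)
  case 0
  then show ?case by (auto simp: hook_step_def)
next
  case (Suc j)
  define d where "d = q * Suc j"
  have d: "q * Suc (Suc j) = q + d" "d > 0" using Suc.prems(1) by (auto simp: d_def)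
  note IH = Suc.IH[folded d_def, OF Suc.prems(1)]
  have x: "x \<in> X" "x - int q - int d \<notin> X"
    using Suc.prems(3) unfolding hooks_def d(1) by (auto simp: diff_diff_eq)
  show ?case unfolding d
  proof (cases "x - int q \<in> X")
    case False
    let ?X = "bead_move q x X"
    have h: "x \<in> hooks q X" using x False by (simp add: hooks_def)
    have s: "hook_step q X ?X" "?X \<in> maya"
      using Suc.prems(2) h bead_move_maya(1)[OF Suc.prems(2,1) h] by (auto simp: hook_step_def)
    have "x - int q \<in> hooks d ?X" using x d(2) by (auto simp: hooks_def bead_move_def)
    then have "(hook_step q)\<^sup>*\<^sup>* ?X (bead_move d (x - int q) ?X)"
      by (rule IH[OF s(2)])
    moreover have "bead_move d (x - int q) ?X = bead_move (q + d) x X"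
      using x False by (auto simp: bead_move_def)
    ultimately show "(hook_step q)\<^sup>*\<^sup>* X (bead_move (q + d) x X)"
      using s(1) by (simp add: converse_rtranclp_into_rtranclp)
  next
    case True
    let ?X = "bead_move d (x - int q) X"
    have h: "x - int q \<in> hooks d X" using x True by (simp add: hooks_def)
    have s: "(hook_step q)\<^sup>*\<^sup>* X ?X" "?X \<in> maya"
      using IH[OF Suc.prems(2) h] bead_move_maya(1)[OF Suc.prems(2) d(2) h] by auto
    have "x \<in> hooks q ?X" using x d(2) Suc.prems(1) by (auto simp: hooks_def bead_move_def)
    moreover have "bead_move q x ?X = bead_move (q + d) x X"
      using x True d(2) Suc.prems(1) by (auto simp: bead_move_def)
    ultimately have "hook_step q ?X (bead_move (q + d) x X)"
      using s(2) by (auto simp: hook_step_def)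
    then show "(hook_step q)\<^sup>*\<^sup>* X (bead_move (q + d) x X)" using s(1) by simp
  qed
qed

lemma strips_hook_steps:
  assumes "strips k X X'" "v \<le> k"
  shows "(hook_step (2 ^ v))\<^sup>*\<^sup>* X X'"
proof -
  obtain x where x: "X \<in> maya" "x \<in> hooks (2 ^ k) X" "X' = bead_move (2 ^ k) x X"
    using assms by (auto simp: strips_def)
  obtain j where "2 ^ (k - v) = Suc j" using not0_implies_Suc[of "2 ^ (k - v)"] by auto
  then have "2 ^ k = 2 ^ v * Suc j" using assms(2) by (metis le_add_diff_inverse power_add)
  then show ?thesis using multiple_hook_steps[of "2 ^ v" X x j] x by simp
qed

lemma power_bounds_imp_le:
  assumes "(2::nat) ^ v \<le> w" "w < 2 * 2 ^ k"
  shows "v \<le> k"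
proof -
  have "(2::nat) ^ v < 2 ^ Suc k" using assms by simp
  then have "v < Suc k" by (rule power_less_imp_less_exp[rotated]) simp
  then show ?thesis by simp
qed

section \<open>Transport of odd covers to weights below \<open>2 ^ v\<close>\<close>

lemma ex_reduces:
  assumes "X \<in> maya" "odd (syt_count X)"
  obtains A where "reduces (2 ^ v) X A" "A \<in> maya" "odd (syt_count A)"
proof -
  have "\<exists>A. reduces (2 ^ v) X A \<and> A \<in> maya \<and> odd (syt_count A)"
    using assms
  proof (induction "weight X" arbitrary: X rule: less_induct)
    case less
    show ?case
    proof (cases "weight X < 2 ^ v")
      case True
      then have "reduces (2 ^ v) X X" by (simp add: reduces_def)
      then show ?thesis using less.prems by blast
    next
      case False
      then have "weight X > 0" by (metis gr0I zero_less_numeral zero_less_power)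
      then obtain k where k: "2 ^ k \<le> weight X" "weight X < 2 * 2 ^ k" by (rule obtain_power_of_2)
      have vk: "v \<le> k" using power_bounds_imp_le[OF _ k(2)] False by simp
      obtain X' where s: "strips k X X'" using ex_strips[OF less.prems k] .
      have "weight X' < weight X"
        using strips_weight[OF s] zero_less_power[of "2::nat" k] by linarith
      then obtain A where "reduces (2 ^ v) X' A \<and> A \<in> maya \<and> odd (syt_count A)"
        using less strips_maya[OF s] strips_odd[OF s] by blast
      then show ?thesis using reduces_steps[OF _ strips_hook_steps[OF s vk]] by auto
    qed
  qed
  then show ?thesis using that by blast
qed

text \<open>The residue condition says that the added box causes no carry into the digits from
  \<open>2 ^ v\<close> upwards, so \<open>X\<close> and \<open>Y\<close> share these digits and are
  stripped in parallel.\<close>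

lemma reduces_odd_cover:
  assumes "odd_cover X Y" "reduces (2 ^ v) X A" "reduces (2 ^ v) Y B" "weight Y mod 2 ^ v \<noteq> 0"
  shows "odd_cover A B"
  using assms
proof (induction "weight Y" arbitrary: X Y rule: less_induct)
  case less
  have w: "weight Y = Suc (weight X)" using less.prems odd_cover_weight by blast
  show ?case
  proof (cases "weight Y < 2 ^ v")
    case True
    then have "A = X" "B = Y" using reduces_small[of "2 ^ v"] less.prems w by auto
    then show ?thesis using less.prems by simp
  next
    case False
    obtain k where k: "2 ^ k \<le> weight Y" "weight Y < 2 * 2 ^ k"
      using obtain_power_of_2[of "weight Y"] w by auto
    have vk: "v \<le> k" using power_bounds_imp_le[OF _ k(2)] False by simp
    then have dvd: "(2::nat) ^ v dvd 2 ^ k" by (rule le_imp_power_dvd)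
    then have "weight Y \<noteq> 2 ^ k" using less.prems(4) by auto
    then have kX: "2 ^ k \<le> weight X" "weight X < 2 * 2 ^ k" using k w by auto
    obtain X' Y' where s: "strips k X X'" "strips k Y Y'"
      using ex_strips[OF _ _ kX] ex_strips[OF _ _ k] less.prems(1) unfolding odd_cover_def by metis
    have wY: "weight Y' + 2 ^ k = weight Y" using strips_weight[OF s(2)] .
    have 1: "weight Y' < weight Y" using wY zero_less_power[of "2::nat" k] by linarith
    \<comment> \<open>The stripped digit is a multiple of \<open>2 ^ v\<close>, so the condition is
      inherited.\<close>
    have 2: "weight Y' mod 2 ^ v \<noteq> 0"
      using less.prems(4) dvd unfolding wY[symmetric] by (auto simp: mod_0_imp_dvd)
    show ?thesis
      using less.hyps[OF 1 strips_odd_cover[OF less.prems(1) s] _ _ 2] less.prems(2,3)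
        reduces_steps[OF _ strips_hook_steps[OF s(1) vk]] reduces_steps[OF _ strips_hook_steps[OF s(2) vk]]
      by simp
  qed
qed

lemma reduces_lift_unique:
  assumes "odd_cover X Y\<^sub>1" "odd_cover X Y\<^sub>2" "reduces (2 ^ v) Y\<^sub>1 B" "reduces (2 ^ v) Y\<^sub>2 B"
    "weight Y\<^sub>1 mod 2 ^ v \<noteq> 0"
  shows "Y\<^sub>1 = Y\<^sub>2"
  using assms
proof (induction "weight X" arbitrary: X Y\<^sub>1 Y\<^sub>2 rule: less_induct)
  case less
  have w: "weight Y\<^sub>1 = Suc (weight X)" "weight Y\<^sub>2 = Suc (weight X)"
    using less.prems by (blast dest: odd_cover_weight)+
  show ?case
  proof (cases "weight Y\<^sub>1 < 2 ^ v")
    case True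
    then have "B = Y\<^sub>1" "B = Y\<^sub>2" using reduces_small[of "2 ^ v"] less.prems w by auto
    then show ?thesis by simp
  next
    case False
    obtain k where k: "2 ^ k \<le> weight Y\<^sub>1" "weight Y\<^sub>1 < 2 * 2 ^ k"
      using obtain_power_of_2[of "weight Y\<^sub>1"] w by auto
    have vk: "v \<le> k" using power_bounds_imp_le[OF _ k(2)] False by simp
    then have dvd: "(2::nat) ^ v dvd 2 ^ k" by (rule le_imp_power_dvd)
    then have "weight Y\<^sub>1 \<noteq> 2 ^ k" using less.prems(5) by auto
    then have kX: "2 ^ k \<le> weight X" "weight X < 2 * 2 ^ k" using k w by auto
    have k2: "2 ^ k \<le> weight Y\<^sub>2" "weight Y\<^sub>2 < 2 * 2 ^ k" using k w by auto
    obtain X' Y1' Y2' where s: "strips k X X'" "strips k Y\<^sub>1 Y1'" "strips k Y\<^sub>2 Y2'"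
      using ex_strips[OF _ _ kX] ex_strips[OF _ _ k] ex_strips[OF _ _ k2] less.prems(1,2)
      unfolding odd_cover_def by metis
    have 1: "weight X' < weight X"
      using strips_weight[OF s(1)] zero_less_power[of "2::nat" k] by linarith
    have 2: "weight Y1' mod 2 ^ v \<noteq> 0"
      using less.prems(5) dvd unfolding strips_weight[OF s(2), symmetric] by (auto simp: mod_0_imp_dvd)
    have "Y1' = Y2'"
      using less.hyps[OF 1 strips_odd_cover[OF less.prems(1) s(1,2)]
          strips_odd_cover[OF less.prems(2) s(1,3)] _ _ 2] less.prems(3,4)
        reduces_steps[OF _ strips_hook_steps[OF s(2) vk]] reduces_steps[OF _ strips_hook_steps[OF s(3) vk]]
      by simp
    then show ?thesis using lift_unique_up less.prems(1,2) s by blast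
  qed
qed

lemma reduces_lift:
  assumes "X \<in> maya" "odd (syt_count X)" "reduces (2 ^ v) X A" "odd_cover A B" "weight B < 2 ^ v"
  obtains Y where "odd_cover X Y" "reduces (2 ^ v) Y B"
proof -
  have "\<exists>Y. odd_cover X Y \<and> reduces (2 ^ v) Y B"
    using assms
  proof (induction "weight X" arbitrary: X rule: less_induct)
    case less
    show ?case
    proof (cases "weight X < 2 ^ v")
      case True
      then have "A = X" using reduces_small[OF _ True less.prems(3)] by simp
      moreover have "reduces (2 ^ v) B B" using less.prems(5) by (simp add: reduces_def)
      ultimately show ?thesis using less.prems(4) by blast
    next
      case False
      then have "weight X > 0" by (metis gr0I zero_less_numeral zero_less_power)
      then obtain k where k: "2 ^ k \<le> weight X" "weight X < 2 * 2 ^ k" by (rule obtain_power_of_2)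
      have vk: "v \<le> k" using power_bounds_imp_le[OF _ k(2)] False by simp
      then have dvd: "(2::nat) ^ v dvd 2 * 2 ^ k" by (simp add: le_imp_power_dvd)
      \<comment> \<open>Here \<open>B\<close> excludes the carry: its weight is one more than
        \<open>weight X mod 2 ^ v\<close>, and still below \<open>2 ^ v\<close>.\<close>
      have "Suc (weight X mod 2 ^ v) < 2 ^ v"
        using reduces_weight[OF _ less.prems(3)] odd_cover_weight[OF less.prems(4)] less.prems(5) by simp
      then have "Suc (weight X) mod 2 ^ v \<noteq> 0" by (simp add: mod_Suc)
      then have "Suc (weight X) \<noteq> 2 * 2 ^ k" using dvd by auto
      then have w: "Suc (weight X) < 2 * 2 ^ k" using k by simp
      obtain X' where s: "strips k X X'" using ex_strips[OF less.prems(1,2) k] .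
      have "weight X' < weight X"
        using strips_weight[OF s] zero_less_power[of "2::nat" k] by linarith
      moreover have "reduces (2 ^ v) X' A"
        using less.prems(3) reduces_steps[OF _ strips_hook_steps[OF s vk]] by simp
      ultimately obtain Y' where Y': "odd_cover X' Y'" "reduces (2 ^ v) Y' B"
        using less strips_maya[OF s] strips_odd[OF s] by blast
      obtain Y where Y: "odd_cover X Y" "strips k Y Y'"
        using lift_odd_cover[OF less.prems(2) s Y'(1) w] .
      then show ?thesis using Y'(2) reduces_steps[OF _ strips_hook_steps[OF Y(2) vk]] by auto
    qed
  qed
  then show ?thesis using that by blast
qed

section \<open>Odd partitions and their cores\<close>

definition odd_covers :: "nat list \<Rightarrow> nat list \<Rightarrow> bool" where
  "odd_covers \<mu> \<nu> \<longleftrightarrow> \<mu> \<in> odd_partitions \<and> \<nu> \<in> odd_partitions \<and> young_covers \<mu> \<nu>"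

lemma odd_tree_le_odd_covers: "odd_tree_le = odd_covers\<^sup>*\<^sup>*"
  unfolding odd_tree_le_def by (rule arg_cong[of _ _ rtranclp]) (simp add: fun_eq_iff odd_covers_def)

lemma beads_maya: "is_partition \<mu> \<Longrightarrow> beads \<mu> \<in> maya"
  by (simp add: maya_def)

lemma weight_beads [simp]: "is_partition \<mu> \<Longrightarrow> weight (beads \<mu>) = sum_list \<mu>"
  by (simp add: weight_def)

lemma syt_count_beads [simp]: "is_partition \<mu> \<Longrightarrow> syt_count (beads \<mu>) = num_syt \<mu>"
  by (simp add: syt_count_def)

lemma odd_covers_iff_odd_cover:
  "odd_covers \<mu> \<nu> \<longleftrightarrow> is_partition \<mu> \<and> is_partition \<nu> \<and> odd_cover (beads \<mu>) (beads \<nu>)"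
proof -
  have eq: "(\<exists>x\<in>hooks 1 (beads \<nu>). beads \<mu> = bead_move 1 x (beads \<nu>)) \<longleftrightarrow>
      (\<exists>r\<in>beads \<mu>. r + 1 \<notin> beads \<mu> \<and> beads \<nu> = add_box r (beads \<mu>))"
  proof
    assume "\<exists>x\<in>hooks 1 (beads \<nu>). beads \<mu> = bead_move 1 x (beads \<nu>)"
    then obtain x where x: "x \<in> hooks 1 (beads \<nu>)" "beads \<mu> = bead_move 1 x (beads \<nu>)" by blast
    show "\<exists>r\<in>beads \<mu>. r + 1 \<notin> beads \<mu> \<and> beads \<nu> = add_box r (beads \<mu>)"
      by (rule bexI[of _ "x - 1"]) (use hook_add_box[OF x(1)] x(2) in auto)
  next
    assume "\<exists>r\<in>beads \<mu>. r + 1 \<notin> beads \<mu> \<and> beads \<nu> = add_box r (beads \<mu>)"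
    then obtain r where r: "r \<in> beads \<mu>" "r + 1 \<notin> beads \<mu>" "beads \<nu> = add_box r (beads \<mu>)" by blast
    show "\<exists>x\<in>hooks 1 (beads \<nu>). beads \<mu> = bead_move 1 x (beads \<nu>)"
      by (rule bexI[of _ "r + 1"]) (use add_box_hook[OF r(1,2)] r(3) in auto)
  qed
  have "young_covers \<mu> \<nu> \<longleftrightarrow> is_partition \<mu> \<and> is_partition \<nu> \<and>
      (\<exists>r\<in>beads \<mu>. r + 1 \<notin> beads \<mu> \<and> beads \<nu> = add_box r (beads \<mu>))"
    unfolding young_covers_iff_removes_rim_hook eq[symmetric]
    using removes_rim_hook_iff_bead_move[of 1 \<nu> \<mu>, OF zero_less_one] by blast
  then show ?thesis
    unfolding odd_covers_def odd_partitions_def odd_cover_def mem_Collect_eq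
    using beads_maya syt_count_beads by metis
qed

lemma odd_covers_size: "odd_covers \<mu> \<nu> \<Longrightarrow> sum_list \<nu> = Suc (sum_list \<mu>)"
  by (simp add: odd_covers_def young_covers_size)

lemma hook_steps_iff_removes_rim_hooks:
  assumes "q > 0" "is_partition \<mu>" "is_partition \<nu>"
  shows "(hook_step q)\<^sup>*\<^sup>* (beads \<mu>) (beads \<nu>) \<longleftrightarrow> (removes_rim_hook q)\<^sup>*\<^sup>* \<mu> \<nu>"
proof
  assume "(hook_step q)\<^sup>*\<^sup>* (beads \<mu>) (beads \<nu>)"
  then have "\<exists>\<kappa>. is_partition \<kappa> \<and> beads \<kappa> = beads \<nu> \<and> (removes_rim_hook q)\<^sup>*\<^sup>* \<mu> \<kappa>"
  proof (induction rule: rtranclp_induct)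
    case base
    then show ?case using assms(2) by blast
  next
    case (step Y Z)
    then obtain \<kappa> where \<kappa>: "is_partition \<kappa>" "beads \<kappa> = Y" "(removes_rim_hook q)\<^sup>*\<^sup>* \<mu> \<kappa>" by blast
    obtain y where y: "y \<in> hooks q (beads \<kappa>)" "Z = bead_move q y (beads \<kappa>)"
      using step.hyps(2) \<kappa>(2) by (auto simp: hook_step_def)
    have "Z \<in> maya" using bead_move_maya(1)[OF beads_maya[OF \<kappa>(1)] assms(1) y(1)] y(2) by simp
    then obtain \<tau> where \<tau>: "is_partition \<tau>" "Z = beads \<tau>" by (rule mayaE)
    then have "removes_rim_hook q \<kappa> \<tau>"
      using removes_rim_hook_iff_bead_move[OF assms(1), of \<kappa> \<tau>] \<kappa>(1) y by auto
    then show ?case using \<kappa>(3) \<tau> by (metis rtranclp.rtrancl_into_rtrancl)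
  qed
  then show "(removes_rim_hook q)\<^sup>*\<^sup>* \<mu> \<nu>" using beads_inject assms(3) by blast
next
  assume "(removes_rim_hook q)\<^sup>*\<^sup>* \<mu> \<nu>"
  then show "(hook_step q)\<^sup>*\<^sup>* (beads \<mu>) (beads \<nu>)"
  proof (induction rule: rtranclp_induct)
    case (step \<kappa> \<tau>)
    then have "hook_step q (beads \<kappa>) (beads \<tau>)"
      using removes_rim_hook_iff_bead_move[OF assms(1)] by (auto simp: hook_step_def beads_maya)
    then show ?case using step.IH by simp
  qed simp
qed

text \<open>By confluence any irreducible \<open>\<tau>\<close> reached from \<open>\<mu>\<close>
  still reduces to \<open>\<nu>\<close>, hence equals it. For \<open>q = 1\<close> the core is
  \<open>[]\<close> by definition, which agrees with a weight below 1.\<close>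

lemma core_eq:
  assumes q: "q > 0" and \<mu>: "is_partition \<mu>" and \<nu>: "is_partition \<nu>"
    and r: "reduces q (beads \<mu>) (beads \<nu>)"
  shows "core q \<mu> = \<nu>"
proof (cases "q = 1")
  case True
  then have "sum_list \<nu> = 0" using r \<nu> by (simp add: reduces_def)
  then show ?thesis using True sum_list_partition_eq_0[OF \<nu>] by (simp add: core_def)
next
  case False
  have steps: "(hook_step q)\<^sup>*\<^sup>* (beads \<mu>) (beads \<nu>)" and light: "weight (beads \<nu>) < q"
    using r by (simp_all add: reduces_def)
  have "(THE \<nu>. (removes_rim_hook q)\<^sup>*\<^sup>* \<mu> \<nu> \<and> \<not> (\<exists>\<kappa>. removes_rim_hook q \<nu> \<kappa>)) = \<nu>"
  proof (rule the_equality)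
    show "(removes_rim_hook q)\<^sup>*\<^sup>* \<mu> \<nu> \<and> \<not> (\<exists>\<kappa>. removes_rim_hook q \<nu> \<kappa>)"
      using steps light hook_steps_iff_removes_rim_hooks[OF q \<mu> \<nu>] \<nu>
      by (auto dest: removes_rim_hook_size)
  next
    fix \<tau> assume \<tau>: "(removes_rim_hook q)\<^sup>*\<^sup>* \<mu> \<tau> \<and> \<not> (\<exists>\<kappa>. removes_rim_hook q \<tau> \<kappa>)"
    then have "(removes_rim_hook q)\<^sup>*\<^sup>* \<mu> \<tau>" by blast
    then have p: "is_partition \<tau>"
      by (cases rule: rtranclp.cases) (use \<mu> in \<open>auto simp: removes_rim_hook_def\<close>)
    then have "(hook_step q)\<^sup>*\<^sup>* (beads \<mu>) (beads \<tau>)"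
      using \<tau> hook_steps_iff_removes_rim_hooks[OF q \<mu>] by blast
    then have "(hook_step q)\<^sup>*\<^sup>* (beads \<tau>) (beads \<nu>)"
      using hook_steps_to_terminal[OF q steps light_terminal[OF q light]] by blast
    then have "(removes_rim_hook q)\<^sup>*\<^sup>* \<tau> \<nu>"
      using hook_steps_iff_removes_rim_hooks[OF q p \<nu>] by blast
    then show "\<tau> = \<nu>" by (cases rule: converse_rtranclpE) (use \<tau> in blast)+
  qed
  then show ?thesis using False by (simp add: core_def)
qed

lemma core_reduces:
  assumes "\<mu> \<in> odd_partitions"
  shows "core (2 ^ v) \<mu> \<in> odd_partitions" "reduces (2 ^ v) (beads \<mu>) (beads (core (2 ^ v) \<mu>))"
proof -
  have \<mu>: "is_partition \<mu>" "odd (syt_count (beads \<mu>))" using assms by (auto simp: odd_partitions_def)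
  obtain A where A: "reduces (2 ^ v) (beads \<mu>) A" "A \<in> maya" "odd (syt_count A)"
    using ex_reduces[OF beads_maya[OF \<mu>(1)] \<mu>(2)] .
  from A(2) obtain \<nu> where \<nu>: "is_partition \<nu>" "A = beads \<nu>" by (rule mayaE)
  then have "core (2 ^ v) \<mu> = \<nu>" using core_eq[OF _ \<mu>(1) \<nu>(1)] A(1) by simp
  then show "core (2 ^ v) \<mu> \<in> odd_partitions" "reduces (2 ^ v) (beads \<mu>) (beads (core (2 ^ v) \<mu>))"
    using \<nu> A by (simp_all add: odd_partitions_def)
qed

lemma odd_partitions_is_partition: "\<mu> \<in> odd_partitions \<Longrightarrow> is_partition \<mu>"
  by (simp add: odd_partitions_def)

lemma core_size:
  assumes "\<mu> \<in> odd_partitions"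
  shows "sum_list (core (2 ^ v) \<mu>) = sum_list \<mu> mod 2 ^ v"
proof -
  have "weight (beads (core (2 ^ v) \<mu>)) = weight (beads \<mu>) mod 2 ^ v"
    by (rule reduces_weight[OF _ core_reduces(2)[OF assms]]) simp
  then show ?thesis
    using assms core_reduces(1)[OF assms, of v] by (simp add: odd_partitions_is_partition)
qed

lemma odd_covers_core:
  assumes "odd_covers \<mu> \<nu>" "sum_list \<nu> mod 2 ^ v \<noteq> 0"
  shows "odd_covers (core (2 ^ v) \<mu>) (core (2 ^ v) \<nu>)"
proof -
  have o: "\<mu> \<in> odd_partitions" "\<nu> \<in> odd_partitions" using assms by (auto simp: odd_covers_def)
  then show ?thesis
    using reduces_odd_cover[OF _ core_reduces(2)[OF o(1)] core_reduces(2)[OF o(2)]] assms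
      core_reduces(1)
    by (simp add: odd_covers_iff_odd_cover odd_partitions_is_partition)
qed

lemma odd_covers_lift:
  assumes "\<mu> \<in> odd_partitions" "odd_covers (core (2 ^ v) \<mu>) \<kappa>" "sum_list \<kappa> < 2 ^ v"
  obtains \<nu> where "odd_covers \<mu> \<nu>" "core (2 ^ v) \<nu> = \<kappa>"
proof -
  have p: "is_partition \<mu>" "odd (syt_count (beads \<mu>))" using assms(1) by (auto simp: odd_partitions_def)
  have \<kappa>: "is_partition \<kappa>" "odd_cover (beads (core (2 ^ v) \<mu>)) (beads \<kappa>)"
    using assms(2) by (auto simp: odd_covers_iff_odd_cover)
  obtain Y where Y: "odd_cover (beads \<mu>) Y" "reduces (2 ^ v) Y (beads \<kappa>)"
    using reduces_lift[OF beads_maya[OF p(1)] p(2) core_reduces(2)[OF assms(1)] \<kappa>(2)] assms(3) \<kappa>(1)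
    by auto
  have "Y \<in> maya" using Y(1) by (simp add: odd_cover_def)
  then obtain \<nu> where \<nu>: "is_partition \<nu>" "Y = beads \<nu>" by (rule mayaE)
  show ?thesis
  proof (rule that)
    show "odd_covers \<mu> \<nu>" using p \<nu> Y by (simp add: odd_covers_iff_odd_cover)
    show "core (2 ^ v) \<nu> = \<kappa>" using core_eq[OF _ \<nu>(1) \<kappa>(1)] Y \<nu> by simp
  qed
qed

lemma odd_covers_lift_unique:
  assumes "odd_covers \<mu> \<nu>\<^sub>1" "odd_covers \<mu> \<nu>\<^sub>2" "core (2 ^ v) \<nu>\<^sub>1 = core (2 ^ v) \<nu>\<^sub>2"
    "sum_list \<nu>\<^sub>1 mod 2 ^ v \<noteq> 0"
  shows "\<nu>\<^sub>1 = \<nu>\<^sub>2"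
proof -
  have o: "\<nu>\<^sub>1 \<in> odd_partitions" "\<nu>\<^sub>2 \<in> odd_partitions" using assms by (auto simp: odd_covers_def)
  then have p: "is_partition \<nu>\<^sub>1" "is_partition \<nu>\<^sub>2" by (simp_all add: odd_partitions_is_partition)
  have c: "odd_cover (beads \<mu>) (beads \<nu>\<^sub>1)" "odd_cover (beads \<mu>) (beads \<nu>\<^sub>2)"
    using assms(1,2) by (simp_all add: odd_covers_iff_odd_cover)
  have "beads \<nu>\<^sub>1 = beads \<nu>\<^sub>2"
  proof (rule reduces_lift_unique[OF c])
    show "reduces (2 ^ v) (beads \<nu>\<^sub>1) (beads (core (2 ^ v) \<nu>\<^sub>1))" by (rule core_reduces(2)[OF o(1)])
    show "reduces (2 ^ v) (beads \<nu>\<^sub>2) (beads (core (2 ^ v) \<nu>\<^sub>1))"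
      unfolding assms(3) by (rule core_reduces(2)[OF o(2)])
    show "weight (beads \<nu>\<^sub>1) mod 2 ^ v \<noteq> 0" using assms(4) p by simp
  qed
  then show ?thesis using beads_inject p by blast
qed

lemma odd_covers_parent_unique:
  assumes "odd_covers \<mu>\<^sub>1 \<nu>" "odd_covers \<mu>\<^sub>2 \<nu>"
  shows "\<mu>\<^sub>1 = \<mu>\<^sub>2"
proof (rule beads_inject)
  show "beads \<mu>\<^sub>1 = beads \<mu>\<^sub>2"
    using assms by (intro odd_parent_unique[of _ "beads \<nu>"]) (simp_all add: odd_covers_iff_odd_cover)
qed (use assms in \<open>simp_all add: odd_covers_iff_odd_cover\<close>)

text \<open>An odd sum in the branching rule has an odd term. With
  \<open>odd_covers_parent_unique\<close> this makes the odd partitions a tree rooted at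
  \<open>[]\<close>.\<close>

lemma ex_odd_parent:
  assumes "\<nu> \<in> odd_partitions" "\<nu> \<noteq> []"
  obtains \<mu> where "odd_covers \<mu> \<nu>"
proof -
  have "odd (\<Sum>\<kappa> | young_covers \<kappa> \<nu>. num_syt \<kappa>)"
    using num_syt_rec[of \<nu>] assms by (simp add: odd_partitions_def)
  then obtain \<mu> where "young_covers \<mu> \<nu>" "odd (num_syt \<mu>)"
    using dvd_sum[of "{\<kappa>. young_covers \<kappa> \<nu>}" 2 num_syt] by blast
  then have "odd_covers \<mu> \<nu>"
    using assms by (auto simp: odd_covers_def odd_partitions_def young_covers_def)
  then show ?thesis by (rule that)
qed

lemma odd_tree_le_Nil:
  assumes "\<nu> \<in> odd_partitions"
  shows "odd_covers\<^sup>*\<^sup>* [] \<nu>"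
  using assms
proof (induction "sum_list \<nu>" arbitrary: \<nu> rule: less_induct)
  case less
  show ?case
  proof (cases "\<nu> = []")
    case False
    then obtain \<mu> where \<mu>: "odd_covers \<mu> \<nu>" using ex_odd_parent less.prems by blast
    then have "odd_covers\<^sup>*\<^sup>* [] \<mu>"
      using less.hyps[of \<mu>] odd_covers_size[OF \<mu>] by (simp add: odd_covers_def)
    then show ?thesis using \<mu> by simp
  qed simp
qed

lemma odd_covers_steps_size: "odd_covers\<^sup>*\<^sup>* \<mu> \<nu> \<Longrightarrow> sum_list \<mu> \<le> sum_list \<nu>"
proof (induction rule: rtranclp_induct)
  case (step \<kappa> \<nu>)
  then show ?case using odd_covers_size[OF step.hyps(2)] by simp
qed simp

lemma doubleton_young_edge:
  "{\<mu>, \<nu>} \<in> young_edges \<longleftrightarrow> young_covers \<mu> \<nu> \<or> young_covers \<nu> \<mu>"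
  by (auto simp: young_edges_def doubleton_eq_iff)

theorem theorem3p4:
  fixes v n :: nat and \<rho> :: "nat list"
  assumes "n > 0"
    and "v \<le> multiplicity 2 n"
    and "\<rho> \<in> odd_partitions"
    and "sum_list \<rho> = n"
  shows "rooted_graph_iso (core (2 ^ v)) (odd_subtree \<rho> (2 ^ v - 1)) (odd_subtree [] (2 ^ v - 1))"
proof -
  let ?q = "2 ^ v :: nat" and ?c = "core (2 ^ v)"
  obtain m where m: "?q = Suc m" using not0_implies_Suc[of ?q] by auto
  \<comment> \<open>Sizes in the source tree thus run through the residues from 0 to
    \<open>2 ^ v - 1\<close> without wrapping, and the core loses exactly \<open>n\<close>
    cells.\<close>
  have nq: "n mod ?q = 0"
    using assms(2) by (simp add: multiplicity_dvd')
  define V where "V = {\<mu> \<in> odd_partitions. odd_tree_le \<rho> \<mu> \<and> sum_list \<rho> \<le> sum_list \<mu> \<and>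
    sum_list \<mu> \<le> sum_list \<rho> + (?q - 1)}"
  define V' where "V' = {\<mu> \<in> odd_partitions. odd_tree_le [] \<mu> \<and> sum_list [] \<le> sum_list \<mu> \<and>
    sum_list \<mu> \<le> sum_list [] + (?q - 1)}"
  have V: "\<mu> \<in> V \<longleftrightarrow> \<mu> \<in> odd_partitions \<and> odd_covers\<^sup>*\<^sup>* \<rho> \<mu> \<and> sum_list \<mu> < n + ?q" for \<mu>
    using odd_covers_steps_size[of \<rho> \<mu>] assms(4)
    unfolding V_def odd_tree_le_odd_covers m by auto
  have V': "\<nu> \<in> V' \<longleftrightarrow> \<nu> \<in> odd_partitions \<and> sum_list \<nu> < ?q" for \<nu>
    using odd_tree_le_Nil unfolding V'_def odd_tree_le_odd_covers m by auto
  have size: "sum_list \<mu> = n + sum_list (?c \<mu>)" if "\<mu> \<in> V" for \<mu>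
  proof -
    have \<mu>: "\<mu> \<in> odd_partitions" "n \<le> sum_list \<mu>" "sum_list \<mu> - n < ?q"
      using that V odd_covers_steps_size[of \<rho> \<mu>] assms(4) by auto
    have "sum_list \<mu> mod ?q = (n + (sum_list \<mu> - n)) mod ?q" using \<mu>(2) by simp
    also have "\<dots> = sum_list \<mu> - n" using nq \<mu>(3) by (metis mod_add_left_eq add_0 mod_less)
    finally show ?thesis using core_size[OF \<mu>(1)] \<mu>(2) by simp
  qed
  \<comment> \<open>The last edge of the path from \<open>\<rho>\<close> stays in \<open>V\<close>;
    it maps to an edge because a nonempty core means that the size is not divisible by
    \<open>2 ^ v\<close>.\<close>
  have parent: "\<exists>\<kappa>\<in>V. odd_covers \<kappa> \<mu> \<and> odd_covers (?c \<kappa>) (?c \<mu>)" if "\<mu> \<in> V" "?c \<mu> \<noteq> []" for \<mu>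
  proof -
    have \<mu>: "\<mu> \<in> odd_partitions" "odd_covers\<^sup>*\<^sup>* \<rho> \<mu>" "sum_list \<mu> < n + ?q" using that V by auto
    have pos: "sum_list (?c \<mu>) \<noteq> 0"
      using that(2) sum_list_partition_eq_0 core_reduces(1)[OF \<mu>(1)] odd_partitions_is_partition by blast
    then have "\<mu> \<noteq> \<rho>" using size[OF that(1)] assms(4) by auto
    with \<mu>(2) obtain \<kappa> where \<kappa>: "odd_covers\<^sup>*\<^sup>* \<rho> \<kappa>" "odd_covers \<kappa> \<mu>" by (metis rtranclp.cases)
    then have "\<kappa> \<in> V" using V odd_covers_size[OF \<kappa>(2)] \<mu>(3) by (auto simp: odd_covers_def)
    moreover have "odd_covers (?c \<kappa>) (?c \<mu>)"
      using odd_covers_core[OF \<kappa>(2)] pos core_size[OF \<mu>(1)] by simp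
    ultimately show ?thesis using \<kappa>(2) by blast
  qed
  have root: "\<mu> = \<rho>" if "\<mu> \<in> V" "?c \<mu> = []" for \<mu>
  proof -
    have "odd_covers\<^sup>*\<^sup>* \<rho> \<mu>" "sum_list \<mu> = sum_list \<rho>" using that V size[OF that(1)] assms(4) by auto
    then show ?thesis
    proof (cases rule: rtranclp.cases)
      case (rtrancl_into_rtrancl \<kappa>)
      then show ?thesis
        using odd_covers_steps_size[of \<rho> \<kappa>] odd_covers_size[of \<kappa> \<mu>] \<open>sum_list \<mu> = sum_list \<rho>\<close> by simp
    qed simp
  qed
  have \<rho>V: "\<rho> \<in> V" using V assms by simp
  have c\<rho>: "?c \<rho> = []"
    using size[OF \<rho>V] assms(4) sum_list_partition_eq_0 core_reduces(1)[OF assms(3)]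
      odd_partitions_is_partition by simp
  \<comment> \<open>Equal cores have the same unique odd parent, so the parents in \<open>V\<close>
    agree by induction; then the lifted edge is unique.\<close>
  have inj: "\<mu> = \<nu>" if "\<mu> \<in> V" "\<nu> \<in> V" "?c \<mu> = ?c \<nu>" for \<mu> \<nu>
    using that
  proof (induction "sum_list (?c \<mu>)" arbitrary: \<mu> \<nu> rule: less_induct)
    case less
    show ?case
    proof (cases "?c \<mu> = []")
      case True
      then show ?thesis using root less.prems by metis
    next
      case False
      obtain \<mu>' where \<mu>': "\<mu>' \<in> V" "odd_covers \<mu>' \<mu>" "odd_covers (?c \<mu>') (?c \<mu>)"
        using parent[OF less.prems(1) False] by blast
      obtain \<nu>' where \<nu>': "\<nu>' \<in> V" "odd_covers \<nu>' \<nu>" "odd_covers (?c \<nu>') (?c \<nu>)"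
        using parent[OF less.prems(2)] False less.prems(3) by auto
      have "?c \<mu>' = ?c \<nu>'" using odd_covers_parent_unique \<mu>'(3) \<nu>'(3) less.prems(3) by metis
      then have "\<mu>' = \<nu>'"
        using less.hyps[of \<mu>' \<nu>'] \<mu>'(1) \<nu>'(1) odd_covers_size[OF \<mu>'(3)] by simp
      moreover have "sum_list \<mu> mod ?q \<noteq> 0"
        using core_size[of \<mu> v] \<mu>'(2) odd_covers_size[OF \<mu>'(3)] by (simp add: odd_covers_def)
      ultimately show ?thesis
        using odd_covers_lift_unique \<mu>'(2) \<nu>'(2) less.prems(3) by blast
    qed
  qed
  \<comment> \<open>The path from \<open>[]\<close> is lifted edge by edge, which also yields the
    path from \<open>\<rho>\<close> required by the tree order.\<close>
  have surj: "\<exists>\<mu>\<in>V. ?c \<mu> = \<nu>" if "\<nu> \<in> odd_partitions" "sum_list \<nu> < ?q" for \<nu>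
    using that
  proof (induction "sum_list \<nu>" arbitrary: \<nu> rule: less_induct)
    case less
    show ?case
    proof (cases "\<nu> = []")
      case True
      then show ?thesis using \<rho>V c\<rho> by blast
    next
      case False
      then obtain \<nu>' where \<nu>': "odd_covers \<nu>' \<nu>" using ex_odd_parent less.prems by blast
      then obtain \<mu>' where \<mu>': "\<mu>' \<in> V" "?c \<mu>' = \<nu>'"
        using less.hyps[of \<nu>'] less.prems odd_covers_size[OF \<nu>'] by (auto simp: odd_covers_def)
      then have "\<mu>' \<in> odd_partitions" using V by blast
      then obtain \<mu> where \<mu>: "odd_covers \<mu>' \<mu>" "?c \<mu> = \<nu>"
        using odd_covers_lift[of \<mu>' v \<nu>] \<nu>' \<mu>'(2) less.prems(2) by blast
      have "sum_list \<mu> = n + sum_list \<nu>"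
        using size[OF \<mu>'(1)] odd_covers_size[OF \<mu>(1)] odd_covers_size[OF \<nu>'] \<mu>'(2) by simp
      then have "\<mu> \<in> V"
        using \<mu>(1) \<mu>'(1) V less.prems(2) by (auto simp: odd_covers_def intro: rtranclp.rtrancl_into_rtrancl)
      then show ?thesis using \<mu>(2) by blast
    qed
  qed
  have into: "?c \<mu> \<in> V'" if "\<mu> \<in> V" for \<mu>
    using that V V' core_reduces(1) core_size by simp
  have "?c ` V = V'" using surj V' into by (metis (no_types, lifting) image_iff subsetI subset_antisym)
  then have bij: "bij_betw ?c V V'" using inj by (auto simp: bij_betw_def inj_on_def)
  have up: "young_covers \<mu> \<nu> \<longleftrightarrow> young_covers (?c \<mu>) (?c \<nu>)" if "\<mu> \<in> V" "\<nu> \<in> V" for \<mu> \<nu>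
  proof
    assume "young_covers \<mu> \<nu>"
    then have *: "odd_covers \<mu> \<nu>" using that V by (simp add: odd_covers_def)
    then have "sum_list (?c \<nu>) = Suc (sum_list (?c \<mu>))"
      using size[OF that(1)] size[OF that(2)] odd_covers_size by simp
    then show "young_covers (?c \<mu>) (?c \<nu>)"
      using odd_covers_core[OF *, of v] core_size[of \<nu> v] * by (simp add: odd_covers_def)
  next
    \<comment> \<open>The parent of \<open>\<nu>\<close> in \<open>V\<close> and
      \<open>\<mu>\<close> have the same core, namely the only odd parent of the core of
      \<open>\<nu>\<close>, so injectivity identifies them.\<close>
    assume "young_covers (?c \<mu>) (?c \<nu>)"
    then have *: "odd_covers (?c \<mu>) (?c \<nu>)" using that into V' by (simp add: odd_covers_def)
    then have "?c \<nu> \<noteq> []" using odd_covers_size by force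
    from parent[OF that(2) this]
    obtain \<kappa> where \<kappa>: "\<kappa> \<in> V" "odd_covers \<kappa> \<nu>" "odd_covers (?c \<kappa>) (?c \<nu>)"
      by blast
    then have "\<kappa> = \<mu>" using odd_covers_parent_unique[OF \<kappa>(3) *] inj that(1) by blast
    then show "young_covers \<mu> \<nu>" using \<kappa>(2) by (simp add: odd_covers_def)
  qed
  have edges: "\<forall>\<mu>\<in>V. \<forall>\<nu>\<in>V. {\<mu>, \<nu>} \<in> {e \<in> young_edges. e \<subseteq> V} \<longleftrightarrow>
      {?c \<mu>, ?c \<nu>} \<in> {e \<in> young_edges. e \<subseteq> V'}"
    using up into by (simp add: doubleton_young_edge)
  show ?thesis
    using bij edges c\<rho> by (simp add: odd_subtree_def young_induced_def V_def V'_def)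
qed

end
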